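(* Under the standing assumptions on $G_n$, $\mathcal S$ and the weights given in the context, for any $\beta\in[0,\infty)$, $$\log Z(\beta)-m\psi(\beta)\Rightarrow \mathrm{N}\left(-\gamma v_\beta^2,\,2\gamma v_\beta^2\right)\quad\text{as } n\to\infty,$$ where $\gamma=\lim_{n\to\infty} m^2/(2|E_n|)\in(0,\infty)$, $v_\beta^2=e^{\psi(2\beta)-2\psi(\beta)}-1$, and $\Rightarrow$ denotes convergence in distribution.
   Context: Graphs: $G_n=(V_n,E_n)$, $n\in\mathbb N$, is a sequence of finite undirected edge-transitive graphs with $|V_n|=c\cdot n$ for some fixed $c\in\mathbb N$ and $|E_n|=\Theta(|V_n|^2)$. Weights: $\{\omega_e\}_{e\in E_n}$ are i.i.d. with a law not depending on $n$ and such that $\psi(\beta):=\log\mathbb E e^{-\beta\omega_e}<\infty$ for all $\beta\in[0,\infty)$. Weights may equal $+\infty$ with positive probability (but not almost surely), with the convention $e^{-\beta\cdot(+\infty)}=0$ for every $\beta\ge0$. Optimization problem: $\mathcal S=\mathcal S(n)$ is a nonempty collection of spanning subgraphs of $G_n$, identified with their edge sets; $\widetilde{\mathcal S}$ is the collection of all subsets of elements of $\mathcal S$. A partial matching is a set of pairwise vertex-disjoint edges. $\mathbb P_0$ denotes the law of $\pi$ uniform on $\mathcal S$. It is assumed that: (1) all elements of $\mathcal S$ have the same number of edges $m=m(n)$, and $\lim_{n\to\infty} m^2/(2|E_n|)=\gamma\in(0,\infty)$; (2) for every partial matching $\Gamma\subseteq E_n$ there is $\pi\in\mathcal S$ with $\Gamma\subseteq\pi$;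 (3) there is a constant $\rho\in(0,\infty)$ (independent of $n$) such that for every $k\in\mathbb N$ and every partial matching $\Gamma$ with $k$ edges, $\left|\frac{\mathbb P_0(\Gamma\subseteq\pi)}{\prod_{e\in\Gamma}\mathbb P_0(e\in\pi)}-1\right|\le \frac{\rho^k}{\sqrt m}$; (4) there is a constant $\rho\in(0,\infty)$ (independent of $n$) such that for every $k\in\mathbb N$ and every $\Gamma\in\widetilde{\mathcal S}$ with $k$ edges that is not a partial matching, $\mathbb P_0(\Gamma\subseteq\pi)\le\rho^k\prod_{e\in\Gamma}\mathbb P_0(e\in\pi)$. Moreover $\mathbb P_0(e\in\pi)=p:=m/|E_n|$ for every $e\in E_n$. Partition function: $W(\pi)=\sum_{e\in\pi}\omega_e$ and $Z(\beta)=\frac1{|\mathcal S|}\sum_{\pi\in\mathcal S}e^{-\beta W(\pi)}$ (with $\log 0=-\infty$). $\mathrm N(\mu,\sigma^2)$ is the normal law with mean $\mu$ and variance $\sigma^2$. *)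

theory Defs
  imports "HOL-Probability.Probability" "HOL-Library.Landau_Symbols"
begin

text \<open>Undirected graphs are simple: a vertex set and a set of two-element subsets of it.\<close>

definition simple_graph :: "'a set \<Rightarrow> 'a set set \<Rightarrow> bool" where
  "simple_graph V E \<longleftrightarrow> finite V \<and> (\<forall>e\<in>E. e \<subseteq> V \<and> card e = 2)"

definition graph_automorphism :: "'a set \<Rightarrow> 'a set set \<Rightarrow> ('a \<Rightarrow> 'a) \<Rightarrow> bool" where
  "graph_automorphism V E \<sigma> \<longleftrightarrow> bij_betw \<sigma> V V \<and> (\<lambda>e. \<sigma> ` e) ` E = E"

definition edge_transitive :: "'a set \<Rightarrow> 'a set set \<Rightarrow> bool" where
  "edge_transitive V E \<longleftrightarrow>
     (\<forall>e\<in>E. \<forall>f\<in>E. \<exists>\<sigma>. graph_automorphism V E \<sigma> \<and> \<sigma> ` e = f)"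

definition partial_matching :: "'a set set \<Rightarrow> 'a set set \<Rightarrow> bool" where
  "partial_matching E \<Gamma> \<longleftrightarrow> \<Gamma> \<subseteq> E \<and> pairwise disjnt \<Gamma>"

text \<open>A spanning subgraph is identified with its edge set, so a collection of spanning
  subgraphs is a set of edge sets.\<close>

definition subset_closure :: "'a set set set \<Rightarrow> 'a set set set" where
  "subset_closure S = {\<Gamma>. \<exists>\<pi>\<in>S. \<Gamma> \<subseteq> \<pi>}"

definition P0 :: "'a set set set \<Rightarrow> ('a set set \<Rightarrow> bool) \<Rightarrow> real" where
  "P0 S A = measure_pmf.prob (pmf_of_set S) {\<pi>. A \<pi>}"

text \<open>The function \<open>x \<mapsto> exp (- \<beta> x)\<close> on \<open>(-\<infinity>, \<infinity>]\<close>, with value \<open>0\<close> at \<open>\<infinity>\<close> also for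
  \<open>\<beta> = 0\<close>. The value at \<open>-\<infinity>\<close> is a dummy; weights are almost surely not \<open>-\<infinity>\<close>.\<close>

definition exp_weight :: "real \<Rightarrow> ereal \<Rightarrow> real" where
  "exp_weight \<beta> x = (if x = \<infinity> then 0 else exp (- \<beta> * real_of_ereal x))"

definition psi :: "ereal measure \<Rightarrow> real \<Rightarrow> real" where
  "psi \<mu> \<beta> = ln (\<integral>x. exp_weight \<beta> x \<partial>\<mu>)"

definition v_squared :: "ereal measure \<Rightarrow> real \<Rightarrow> real" where
  "v_squared \<mu> \<beta> = exp (psi \<mu> (2 * \<beta>) - 2 * psi \<mu> \<beta>) - 1"

definition total_weight :: "('a set \<Rightarrow> ereal) \<Rightarrow> 'a set set \<Rightarrow> ereal" where
  "total_weight w \<pi> = (\<Sum>e\<in>\<pi>. w e)"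

definition partition_function :: "'a set set set \<Rightarrow> ('a set \<Rightarrow> ereal) \<Rightarrow> real \<Rightarrow> real" where
  "partition_function S w \<beta> = (\<Sum>\<pi>\<in>S. exp_weight \<beta> (total_weight w \<pi>)) / real (card S)"

text \<open>The logarithm on \<open>[0, \<infinity>)\<close> with \<open>log 0 = -\<infinity>\<close> (the library has \<open>ln 0 = 0\<close>).\<close>

definition log_ext :: "real \<Rightarrow> ereal" where
  "log_ext z = (if z = 0 then -\<infinity> else ereal (ln z))"

text \<open>Weak convergence of measures on a topological space by bounded continuous test functions;
  the library notion \<open>weak_conv_m\<close> only covers measures on the real line, whereas
  \<open>log Z\<close> may take the value \<open>-\<infinity>\<close>.\<close>

definition weak_convergence ::
  "(nat \<Rightarrow> 'b::topological_space measure) \<Rightarrow> 'b measure \<Rightarrow> bool" where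
  "weak_convergence N L \<longleftrightarrow>
     (\<forall>f::'b \<Rightarrow> real. continuous_on UNIV f \<and> bounded (range f) \<longrightarrow>
        (\<lambda>n. \<integral>x. f x \<partial>(N n)) \<longlonglongrightarrow> (\<integral>x. f x \<partial>L))"

text \<open>The normal law with mean \<open>\<mu>\<close> and variance \<open>s\<close>, which is the point mass at \<open>\<mu>\<close> if \<open>s = 0\<close>.
  Note that \<open>normal_density\<close> is parametrised by the standard deviation.\<close>

definition normal_law :: "real \<Rightarrow> real \<Rightarrow> real measure" where
  "normal_law \<mu> s =
     (if s = 0 then return borel \<mu> else density lborel (\<lambda>x. ennreal (normal_density \<mu> (sqrt s) x)))"

end

theory Submission
  imports Defs
begin

text \<open>Put \<open>\<zeta>\<^sub>e = exp (- \<beta> \<omega>\<^sub>e - \<psi>(\<beta>)) - 1\<close>, which is centred with variance \<open>v\<^sub>\<beta>\<^sup>2\<close>. Then \<open>Z(\<beta>) exp (- m \<psi>(\<beta>))\<close> is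
  the polynomial chaos \<open>\<Sum>\<^sub>\<Gamma> P\<^sub>0(\<Gamma> \<subseteq> \<pi>) \<Prod>\<^sub>e\<^sub>\<in>\<^sub>\<Gamma> \<zeta>\<^sub>e\<close>, whose monomials are orthogonal in \<open>L\<^sup>2\<close>. Replacing every
  coefficient by \<open>p\<^bsup>|\<Gamma>|\<^esup>\<close> turns the sum into the product \<open>\<Prod>\<^sub>e (1 + p \<zeta>\<^sub>e)\<close>. The \<open>L\<^sup>2\<close> error vanishes:
  matchings contribute \<open>O(1/m)\<close>, and a set which is not a matching contains one of the
  \<open>O(|V| |E|)\<close> pairs of intersecting edges, each of which costs a factor \<open>O(p\<^sup>4)\<close>, in total
  \<open>O(|V| / |E|)\<close>. The logarithm of the product is a sum of i.i.d. variables, with characteristic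
  function \<open>E[(1 + p \<zeta>)\<^bsup>it\<^esup>]\<^bsup>|E|\<^esup> = (1 + it(it - 1) p\<^sup>2 v\<^sub>\<beta>\<^sup>2 / 2 + O(p\<^sup>3))\<^bsup>|E|\<^esup>\<close>, which tends to
  \<open>exp (\<gamma> v\<^sub>\<beta>\<^sup>2 it(it - 1))\<close> since \<open>|E| p\<^sup>2 \<rightarrow> 2 \<gamma>\<close>.\<close>

section \<open>Subsets containing intersecting edges\<close>

lemma sum_Pow_power_card:
  fixes a :: "'c::comm_semiring_1"
  assumes "finite A"
  shows "(\<Sum>X\<in>Pow A. a ^ card X) = (1 + a) ^ card A"
  using prod_add[OF assms, of "\<lambda>_. a" "\<lambda>_. 1"] by (simp add: add.commute)

text \<open>Deleting \<open>e\<close> and \<open>f\<close> is a bijection onto the subsets of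
  \<open>A - {e, f}\<close> and releases a factor \<open>a\<close> for each of the two elements; the
  binomial theorem sums the rest.\<close>

lemma sum_Pow_power_card_two_le:
  fixes a :: real
  assumes "finite A" "a \<ge> 0" "e \<in> A" "f \<in> A" "e \<noteq> f"
  shows "(\<Sum>X | X \<subseteq> A \<and> e \<in> X \<and> f \<in> X. a ^ card X) \<le> a\<^sup>2 * (1 + a) ^ card A"
proof -
  let ?B = "A - {e, f}"
  have "(\<Sum>X | X \<subseteq> A \<and> e \<in> X \<and> f \<in> X. a ^ card X) = (\<Sum>X\<in>Pow ?B. a\<^sup>2 * a ^ card X)"
  proof (rule sum.reindex_bij_witness[where i = "\<lambda>X. insert e (insert f X)" and j = "\<lambda>X. X - {e, f}"])
    fix X assume X: "X \<in> {X. X \<subseteq> A \<and> e \<in> X \<and> f \<in> X}"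
    then have "finite X" using assms finite_subset by auto
    then have "card X = card (X - {e, f}) + 2"
      using X assms by (subst card_Diff_subset) (auto intro!: le_add_diff_inverse2[symmetric] dest: card_mono[of X "{e, f}"])
    then show "a\<^sup>2 * a ^ card (X - {e, f}) = a ^ card X" by (simp add: power2_eq_square mult.assoc)
  qed (use assms in auto)
  also have "\<dots> = a\<^sup>2 * (1 + a) ^ card ?B"
    using assms by (simp add: sum_distrib_left[symmetric] sum_Pow_power_card)
  also have "\<dots> \<le> a\<^sup>2 * (1 + a) ^ card A"
    using assms by (intro mult_left_mono power_increasing card_mono) auto
  finally show ?thesis .
qed

text \<open>Given \<open>e\<close>, a partner \<open>f\<close> is determined by a common vertex
  \<open>v\<close>, with two choices in \<open>e\<close>, and by its other endpoint
  \<open>u\<close>. So each edge has at most \<open>2 * card V\<close> partners, which improves on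
  the trivial count \<open>card E\<close>.\<close>

lemma card_intersecting_pairs:
  assumes "simple_graph V E"
  shows "finite {(e, f). e \<in> E \<and> f \<in> E \<and> e \<noteq> f \<and> \<not> disjnt e f}"
    and "card {(e, f). e \<in> E \<and> f \<in> E \<and> e \<noteq> f \<and> \<not> disjnt e f} \<le> card E * (2 * card V)"
proof -
  have V: "finite V" and E: "\<And>e. e \<in> E \<Longrightarrow> e \<subseteq> V \<and> card e = 2"
    using assms by (auto simp: simple_graph_def)
  then have fE: "finite E" by (meson PowI finite_Pow_iff finite_subset subsetI)
  \<comment> \<open>The choice \<open>u = v\<close> puts singletons into the image; they only
    enlarge the upper bound.\<close>
  let ?I = "SIGMA e:E. (\<lambda>(v, u). {v, u}) ` (e \<times> V)"
  have sub: "{(e, f). e \<in> E \<and> f \<in> E \<and> e \<noteq> f \<and> \<not> disjnt e f} \<subseteq> ?I"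
  proof (rule subrelI)
    fix e f assume "(e, f) \<in> {(e, f). e \<in> E \<and> f \<in> E \<and> e \<noteq> f \<and> \<not> disjnt e f}"
    then have ef: "e \<in> E" "f \<in> E" "\<not> disjnt e f" by auto
    then obtain v where v: "v \<in> e" "v \<in> f" by (auto simp: disjnt_def)
    from E[OF ef(2)] obtain x y where "f = {x, y}" by (auto simp: card_2_iff)
    with v obtain u where "f = {v, u}" by auto
    then show "(e, f) \<in> ?I" using E[OF ef(2)] v ef(1) by auto
  qed
  have fin: "finite ?I" using fE V E by (auto intro!: finite_SigmaI dest: finite_subset)
  show "finite {(e, f). e \<in> E \<and> f \<in> E \<and> e \<noteq> f \<and> \<not> disjnt e f}"
    using sub fin finite_subset by blast
  have "card {(e, f). e \<in> E \<and> f \<in> E \<and> e \<noteq> f \<and> \<not> disjnt e f} \<le> card ?I"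
    using sub fin card_mono by blast
  also have "\<dots> = (\<Sum>e\<in>E. card ((\<lambda>(v, u). {v, u}) ` (e \<times> V)))"
    using fE V E by (intro card_SigmaI) (auto dest: finite_subset)
  also have "\<dots> \<le> (\<Sum>e\<in>E. 2 * card V)"
  proof (rule sum_mono)
    fix e assume e: "e \<in> E"
    then have "finite (e \<times> V)" using E V by (auto dest: finite_subset)
    from card_image_le[OF this, of "\<lambda>(v, u). {v, u}"] show
      "card ((\<lambda>(v, u). {v, u}) ` (e \<times> V)) \<le> 2 * card V" using E[OF e] by (simp add: card_cartesian_product)
  qed
  finally show "card {(e, f). e \<in> E \<and> f \<in> E \<and> e \<noteq> f \<and> \<not> disjnt e f} \<le> card E * (2 * card V)"
    by simp
qed

text \<open>Union bound: a set of edges that is not a matching contains an ordered pair from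
  \<open>I\<close>, so it is counted at least once when summing over pairs, and each pair costs
  \<open>a\<^sup>2\<close>.\<close>

lemma sum_nonmatchings_le:
  fixes a :: real
  assumes "simple_graph V E" "a \<ge> 0"
  shows "(\<Sum>\<Gamma> | \<Gamma> \<subseteq> E \<and> \<not> partial_matching E \<Gamma>. a ^ card \<Gamma>)
    \<le> 2 * card V * card E * a\<^sup>2 * (1 + a) ^ card E"
proof -
  define I where "I = {(e, f). e \<in> E \<and> f \<in> E \<and> e \<noteq> f \<and> \<not> disjnt e f}"
  have I: "finite I" "card I \<le> card E * (2 * card V)"
    using card_intersecting_pairs[OF assms(1)] by (auto simp: I_def)
  have fE: "finite E" using assms by (auto simp: simple_graph_def intro: finite_subset[of E "Pow V"])
  let ?b = "\<lambda>\<Gamma> ef. if fst ef \<in> \<Gamma> \<and> snd ef \<in> \<Gamma> then a ^ card \<Gamma> else 0"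
  have "(\<Sum>\<Gamma> | \<Gamma> \<subseteq> E \<and> \<not> partial_matching E \<Gamma>. a ^ card \<Gamma>)
      \<le> (\<Sum>\<Gamma> | \<Gamma> \<subseteq> E \<and> \<not> partial_matching E \<Gamma>. \<Sum>ef\<in>I. ?b \<Gamma> ef)"
  proof (rule sum_mono)
    fix \<Gamma> assume "\<Gamma> \<in> {\<Gamma>. \<Gamma> \<subseteq> E \<and> \<not> partial_matching E \<Gamma>}"
    then obtain e f where ef: "e \<in> \<Gamma>" "f \<in> \<Gamma>" "(e, f) \<in> I"
      by (auto simp: partial_matching_def pairwise_def I_def)
    have "?b \<Gamma> (e, f) \<le> (\<Sum>ef\<in>I. ?b \<Gamma> ef)"
      using ef I assms by (intro member_le_sum) auto
    then show "a ^ card \<Gamma> \<le> (\<Sum>ef\<in>I. ?b \<Gamma> ef)" using ef by simp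
  qed
  also have "\<dots> \<le> (\<Sum>\<Gamma>\<in>Pow E. \<Sum>ef\<in>I. ?b \<Gamma> ef)"
    using fE assms by (intro sum_mono2) (auto intro!: sum_nonneg)
  also have "\<dots> = (\<Sum>ef\<in>I. \<Sum>\<Gamma>\<in>Pow E. ?b \<Gamma> ef)" by (rule sum.swap)
  also have "\<dots> \<le> (\<Sum>ef\<in>I. a\<^sup>2 * (1 + a) ^ card E)"
  proof (rule sum_mono)
    fix ef assume ef: "ef \<in> I"
    have "(\<Sum>\<Gamma>\<in>Pow E. ?b \<Gamma> ef) = (\<Sum>X | X \<subseteq> E \<and> fst ef \<in> X \<and> snd ef \<in> X. a ^ card X)"
      using fE by (subst sum.inter_filter[symmetric]) (auto intro!: sum.cong)
    also have "\<dots> \<le> a\<^sup>2 * (1 + a) ^ card E"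
      using ef fE assms by (intro sum_Pow_power_card_two_le) (auto simp: I_def)
    finally show "(\<Sum>\<Gamma>\<in>Pow E. ?b \<Gamma> ef) \<le> a\<^sup>2 * (1 + a) ^ card E" .
  qed
  also have "\<dots> \<le> real (card E * (2 * card V)) * (a\<^sup>2 * (1 + a) ^ card E)"
    using I(2) assms by (simp del: of_nat_mult) (intro mult_right_mono of_nat_mono, auto)
  finally show ?thesis by (simp add: algebra_simps)
qed

text \<open>The factor \<open>s ^ card \<Gamma>\<close> will be the second moment of the monomial of
  \<Gamma>, so the left side is a squared L2 error. Matchings gain \<delta> from their small
  relative error, all other sets are paid for by the scarcity of intersecting pairs. In the
  application \<open>card E * a\<close> converges, so the exponential stays bounded.\<close>

lemma sum_coefficient_error_le:
  fixes q :: "'a set set \<Rightarrow> real" and p s R \<delta> a :: real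
  assumes graph: "simple_graph V E" and s: "s \<ge> 0"
    and matching: "\<And>\<Gamma>. partial_matching E \<Gamma> \<Longrightarrow> \<bar>q \<Gamma> - p ^ card \<Gamma>\<bar> \<le> \<delta> * (R * p) ^ card \<Gamma>"
    and nonmatching: "\<And>\<Gamma>. \<Gamma> \<subseteq> E \<Longrightarrow> \<not> partial_matching E \<Gamma> \<Longrightarrow> \<bar>q \<Gamma> - p ^ card \<Gamma>\<bar> \<le> (R * p) ^ card \<Gamma>"
    and a_def: "a = (R * p)\<^sup>2 * s"
  shows "(\<Sum>\<Gamma>\<in>Pow E. (q \<Gamma> - p ^ card \<Gamma>)\<^sup>2 * s ^ card \<Gamma>)
    \<le> (\<delta>\<^sup>2 + 2 * card V * card E * a\<^sup>2) * exp (card E * a)"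
proof -
  have a: "a \<ge> 0" using s by (simp add: a_def)
  have fE: "finite E" using graph by (auto simp: simple_graph_def intro: finite_subset[of E "Pow V"])
  have pow: "((R * p) ^ k)\<^sup>2 * s ^ k = a ^ k" for k
    by (simp add: a_def power_mult_distrib power_mult[symmetric] mult.commute)
  have le: "d\<^sup>2 * s ^ k \<le> \<epsilon>\<^sup>2 * a ^ k" if "\<bar>d\<bar> \<le> \<epsilon> * (R * p) ^ k" for d \<epsilon> k
  proof -
    have "d\<^sup>2 \<le> (\<epsilon> * (R * p) ^ k)\<^sup>2" using that by (metis abs_ge_zero power2_abs power_mono)
    then have "d\<^sup>2 * s ^ k \<le> (\<epsilon> * (R * p) ^ k)\<^sup>2 * s ^ k" using s by (intro mult_right_mono) auto
    then show ?thesis using pow[of k] by (simp add: power_mult_distrib[of \<epsilon>] mult.assoc)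
  qed
  let ?d = "\<lambda>\<Gamma>. (q \<Gamma> - p ^ card \<Gamma>)\<^sup>2 * s ^ card \<Gamma>"
  have "Pow E = {\<Gamma>. partial_matching E \<Gamma>} \<union> {\<Gamma>. \<Gamma> \<subseteq> E \<and> \<not> partial_matching E \<Gamma>}"
    by (auto simp: partial_matching_def)
  moreover have "finite {\<Gamma>. partial_matching E \<Gamma>}" "finite {\<Gamma>. \<Gamma> \<subseteq> E \<and> \<not> partial_matching E \<Gamma>}"
    using fE by (auto simp: partial_matching_def intro: finite_subset[of _ "Pow E"])
  ultimately have "(\<Sum>\<Gamma>\<in>Pow E. ?d \<Gamma>) = (\<Sum>\<Gamma> | partial_matching E \<Gamma>. ?d \<Gamma>)
      + (\<Sum>\<Gamma> | \<Gamma> \<subseteq> E \<and> \<not> partial_matching E \<Gamma>. ?d \<Gamma>)"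
    by (simp add: sum.union_disjoint Int_def)
  also have "(\<Sum>\<Gamma> | partial_matching E \<Gamma>. ?d \<Gamma>) \<le> (\<Sum>\<Gamma> | partial_matching E \<Gamma>. \<delta>\<^sup>2 * a ^ card \<Gamma>)"
    using le matching by (intro sum_mono) auto
  also have "\<dots> \<le> (\<Sum>\<Gamma>\<in>Pow E. \<delta>\<^sup>2 * a ^ card \<Gamma>)"
    using fE a by (intro sum_mono2) (auto simp: partial_matching_def)
  also have "\<dots> = \<delta>\<^sup>2 * (1 + a) ^ card E"
    using fE by (simp add: sum_distrib_left[symmetric] sum_Pow_power_card)
  also have "(\<Sum>\<Gamma> | \<Gamma> \<subseteq> E \<and> \<not> partial_matching E \<Gamma>. ?d \<Gamma>)
      \<le> (\<Sum>\<Gamma> | \<Gamma> \<subseteq> E \<and> \<not> partial_matching E \<Gamma>. a ^ card \<Gamma>)"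
    using le[of _ 1] nonmatching by (intro sum_mono) auto
  also have "\<dots> \<le> 2 * card V * card E * a\<^sup>2 * (1 + a) ^ card E"
    using graph a by (rule sum_nonmatchings_le)
  also have "\<delta>\<^sup>2 * (1 + a) ^ card E + 2 * card V * card E * a\<^sup>2 * (1 + a) ^ card E
      = (\<delta>\<^sup>2 + 2 * card V * card E * a\<^sup>2) * (1 + a) ^ card E"
    by (simp add: algebra_simps)
  also have "\<dots> \<le> (\<delta>\<^sup>2 + 2 * card V * card E * a\<^sup>2) * exp (card E * a)"
    unfolding exp_of_nat_mult using a by (intro mult_left_mono power_mono exp_ge_add_one_self) auto
  finally show ?thesis by simp
qed

section \<open>Polynomial chaos\<close>

text \<open>Orthogonality of the monomials. By independence the expectation factorises over the
  edges: an edge in both sets contributes \<open>s\<close>, an edge in neither contributes 1, and a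
  single edge in exactly one of them contributes its mean 0 and kills the product.\<close>

lemma (in prob_space) expectation_prod_mult_prod:
  fixes \<zeta> :: "'b \<Rightarrow> 'a \<Rightarrow> real"
  assumes fin: "finite E" and indep: "indep_vars (\<lambda>_. borel) \<zeta> E"
    and int: "\<And>e. e \<in> E \<Longrightarrow> integrable M (\<zeta> e)" and int2: "\<And>e. e \<in> E \<Longrightarrow> integrable M (\<lambda>x. (\<zeta> e x)\<^sup>2)"
    and mean: "\<And>e. e \<in> E \<Longrightarrow> expectation (\<zeta> e) = 0"
    and var: "\<And>e. e \<in> E \<Longrightarrow> expectation (\<lambda>x. (\<zeta> e x)\<^sup>2) = s"
    and sub: "\<Gamma> \<subseteq> E" "\<Delta> \<subseteq> E"
  shows "integrable M (\<lambda>x. (\<Prod>e\<in>\<Gamma>. \<zeta> e x) * (\<Prod>e\<in>\<Delta>. \<zeta> e x))"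
    and "expectation (\<lambda>x. (\<Prod>e\<in>\<Gamma>. \<zeta> e x) * (\<Prod>e\<in>\<Delta>. \<zeta> e x)) = (if \<Gamma> = \<Delta> then s ^ card \<Gamma> else 0)"
proof -
  \<comment> \<open>Padding both products with factors 1 to all of \<open>E\<close> gives one
    product of functions of independent variables, namely 1, \<zeta> or its square.\<close>
  define h where "h e y = (if e \<in> \<Gamma> then y else 1) * (if e \<in> \<Delta> then y else 1)" for e and y :: real
  have prod: "(\<Prod>e\<in>\<Gamma>. \<zeta> e x) * (\<Prod>e\<in>\<Delta>. \<zeta> e x) = (\<Prod>e\<in>E. h e (\<zeta> e x))" for x
  proof -
    have "(\<Prod>e\<in>X. \<zeta> e x) = (\<Prod>e\<in>E. if e \<in> X then \<zeta> e x else 1)" if "X \<subseteq> E" for X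
      using that fin by (simp add: prod.inter_restrict[symmetric] Int_absorb1)
    then show ?thesis using sub by (simp add: h_def prod.distrib)
  qed
  have ind: "indep_vars (\<lambda>_. borel) (\<lambda>e x. h e (\<zeta> e x)) E"
    by (rule indep_vars_compose2[OF indep]) (auto simp: h_def)
  have int_h: "integrable M (\<lambda>x. h e (\<zeta> e x))" if "e \<in> E" for e
    using int[OF that] int2[OF that]
    by (cases "e \<in> \<Gamma>"; cases "e \<in> \<Delta>") (auto simp: h_def power2_eq_square)
  have exp_h: "expectation (\<lambda>x. h e (\<zeta> e x)) =
      (if e \<in> \<Gamma> \<and> e \<in> \<Delta> then s else if e \<in> \<Gamma> \<or> e \<in> \<Delta> then 0 else 1)" if "e \<in> E" for e
    using mean[OF that] var[OF that]
    by (cases "e \<in> \<Gamma>"; cases "e \<in> \<Delta>") (auto simp: h_def power2_eq_square prob_space)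
  show "integrable M (\<lambda>x. (\<Prod>e\<in>\<Gamma>. \<zeta> e x) * (\<Prod>e\<in>\<Delta>. \<zeta> e x))"
    unfolding prod using indep_vars_integrable[OF fin ind int_h] .
  have "expectation (\<lambda>x. (\<Prod>e\<in>\<Gamma>. \<zeta> e x) * (\<Prod>e\<in>\<Delta>. \<zeta> e x)) =
      (\<Prod>e\<in>E. if e \<in> \<Gamma> \<and> e \<in> \<Delta> then s else if e \<in> \<Gamma> \<or> e \<in> \<Delta> then 0 else 1)"
    using indep_vars_lebesgue_integral[OF fin ind int_h] by (simp add: prod exp_h)
  also have "\<dots> = (if \<Gamma> = \<Delta> then s ^ card \<Gamma> else 0)"
  proof (cases "\<Gamma> = \<Delta>")
    case True
    then have "(\<Prod>e\<in>E. if e \<in> \<Gamma> \<and> e \<in> \<Delta> then s else if e \<in> \<Gamma> \<or> e \<in> \<Delta> then 0 else 1) =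
        (\<Prod>e\<in>E. if e \<in> \<Gamma> then s else 1)" by (intro prod.cong) auto
    then show ?thesis using True sub fin by (simp add: prod.inter_restrict[symmetric] Int_absorb1)
  next
    case False
    then show ?thesis using sub fin by (auto intro!: prod_zero split: if_splits)
  qed
  finally show "expectation (\<lambda>x. (\<Prod>e\<in>\<Gamma>. \<zeta> e x) * (\<Prod>e\<in>\<Delta>. \<zeta> e x)) = (if \<Gamma> = \<Delta> then s ^ card \<Gamma> else 0)" .
qed

text \<open>Expand the square into a double sum; orthogonality leaves only the diagonal.\<close>

lemma (in prob_space) polynomial_chaos_second_moment:
  fixes \<zeta> :: "'b \<Rightarrow> 'a \<Rightarrow> real" and b :: "'b set \<Rightarrow> real"
  assumes fin: "finite E" and indep: "indep_vars (\<lambda>_. borel) \<zeta> E"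
    and int: "\<And>e. e \<in> E \<Longrightarrow> integrable M (\<zeta> e)" and int2: "\<And>e. e \<in> E \<Longrightarrow> integrable M (\<lambda>x. (\<zeta> e x)\<^sup>2)"
    and mean: "\<And>e. e \<in> E \<Longrightarrow> expectation (\<zeta> e) = 0"
    and var: "\<And>e. e \<in> E \<Longrightarrow> expectation (\<lambda>x. (\<zeta> e x)\<^sup>2) = s"
  shows "integrable M (\<lambda>x. (\<Sum>\<Gamma>\<in>Pow E. b \<Gamma> * (\<Prod>e\<in>\<Gamma>. \<zeta> e x))\<^sup>2)"
    and "expectation (\<lambda>x. (\<Sum>\<Gamma>\<in>Pow E. b \<Gamma> * (\<Prod>e\<in>\<Gamma>. \<zeta> e x))\<^sup>2) = (\<Sum>\<Gamma>\<in>Pow E. (b \<Gamma>)\<^sup>2 * s ^ card \<Gamma>)"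
proof -
  note orth = expectation_prod_mult_prod[OF fin indep int int2 mean var]
  have sq: "(\<Sum>\<Gamma>\<in>Pow E. b \<Gamma> * (\<Prod>e\<in>\<Gamma>. \<zeta> e x))\<^sup>2 =
      (\<Sum>\<Gamma>\<in>Pow E. \<Sum>\<Delta>\<in>Pow E. b \<Gamma> * b \<Delta> * ((\<Prod>e\<in>\<Gamma>. \<zeta> e x) * (\<Prod>e\<in>\<Delta>. \<zeta> e x)))" for x
    by (simp add: power2_eq_square sum_product algebra_simps)
  show "integrable M (\<lambda>x. (\<Sum>\<Gamma>\<in>Pow E. b \<Gamma> * (\<Prod>e\<in>\<Gamma>. \<zeta> e x))\<^sup>2)"
    unfolding sq by (intro Bochner_Integration.integrable_sum integrable_mult_right orth(1)) auto
  have "expectation (\<lambda>x. (\<Sum>\<Gamma>\<in>Pow E. b \<Gamma> * (\<Prod>e\<in>\<Gamma>. \<zeta> e x))\<^sup>2) =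
      (\<Sum>\<Gamma>\<in>Pow E. \<Sum>\<Delta>\<in>Pow E. b \<Gamma> * b \<Delta> *
        expectation (\<lambda>x. (\<Prod>e\<in>\<Gamma>. \<zeta> e x) * (\<Prod>e\<in>\<Delta>. \<zeta> e x)))"
    unfolding sq
    by (subst Bochner_Integration.integral_sum, intro Bochner_Integration.integrable_sum integrable_mult_right orth(1), auto)
       (intro sum.cong refl, subst Bochner_Integration.integral_sum, auto intro!: integrable_mult_right orth(1))
  also have "\<dots> = (\<Sum>\<Gamma>\<in>Pow E. \<Sum>\<Delta>\<in>Pow E. if \<Gamma> = \<Delta> then (b \<Gamma>)\<^sup>2 * s ^ card \<Gamma> else 0)"
    by (intro sum.cong refl) (auto simp: orth(2) power2_eq_square)
  also have "\<dots> = (\<Sum>\<Gamma>\<in>Pow E. (b \<Gamma>)\<^sup>2 * s ^ card \<Gamma>)" using fin by simp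
  finally show "expectation (\<lambda>x. (\<Sum>\<Gamma>\<in>Pow E. b \<Gamma> * (\<Prod>e\<in>\<Gamma>. \<zeta> e x))\<^sup>2) = (\<Sum>\<Gamma>\<in>Pow E. (b \<Gamma>)\<^sup>2 * s ^ card \<Gamma>)" .
qed

text \<open>The inequality is nonnegativity of the variance of |X|.\<close>

lemma (in prob_space) expectation_abs_le_sqrt:
  fixes X :: "'a \<Rightarrow> real"
  assumes [measurable]: "X \<in> borel_measurable M" and int: "integrable M (\<lambda>x. (X x)\<^sup>2)"
  shows "integrable M X" "expectation (\<lambda>x. \<bar>X x\<bar>) \<le> sqrt (expectation (\<lambda>x. (X x)\<^sup>2))"
proof -
  show "integrable M X" using square_integrable_imp_integrable[OF _ int] by simp
  then have "(expectation (\<lambda>x. \<bar>X x\<bar>))\<^sup>2 \<le> expectation (\<lambda>x. (X x)\<^sup>2)"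
    using variance_eq[of "\<lambda>x. \<bar>X x\<bar>"] variance_positive[of "\<lambda>x. \<bar>X x\<bar>"] int by simp
  then show "expectation (\<lambda>x. \<bar>X x\<bar>) \<le> sqrt (expectation (\<lambda>x. (X x)\<^sup>2))"
    by (simp add: real_le_rsqrt)
qed

text \<open>The map \<open>x \<mapsto> iexp (t * x)\<close> is Lipschitz with constant |t|: pull out
  a factor of modulus 1 and bound \<open>iexp y - 1\<close> by |y|.\<close>

lemma (in prob_space) char_distr_diff_le:
  fixes A B :: "'a \<Rightarrow> real"
  assumes [measurable]: "A \<in> borel_measurable M" "B \<in> borel_measurable M"
    and int: "integrable M (\<lambda>x. A x - B x)"
  shows "cmod (char (distr M borel A) t - char (distr M borel B) t) \<le> \<bar>t\<bar> * expectation (\<lambda>x. \<bar>A x - B x\<bar>)"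
proof -
  have le: "cmod (iexp (t * a) - iexp (t * b)) \<le> \<bar>t\<bar> * \<bar>a - b\<bar>" for a b
  proof -
    have "iexp (t * a) - iexp (t * b) = iexp (t * b) * (iexp (t * (a - b)) - 1)"
      by (simp add: algebra_simps exp_add[symmetric])
    then show ?thesis using iexp_approx1[of "t * (a - b)" 0]
      by (simp add: norm_mult abs_mult del: of_real_mult)
  qed
  have "char (distr M borel A) t - char (distr M borel B) t = expectation (\<lambda>x. iexp (t * A x) - iexp (t * B x))"
    unfolding char_def
    by (simp add: integral_distr, subst Bochner_Integration.integral_diff)
       (auto intro!: integrable_const_bound[where B = 1] simp del: of_real_mult)
  also have "cmod \<dots> \<le> expectation (\<lambda>x. cmod (iexp (t * A x) - iexp (t * B x)))"
    by (rule integral_norm_bound)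
  also have "\<dots> \<le> expectation (\<lambda>x. \<bar>t\<bar> * \<bar>A x - B x\<bar>)"
    using le int by (intro integral_mono_AE' ) auto
  finally show ?thesis using int by simp
qed

section \<open>Limits of characteristic functions\<close>

text \<open>Composition with this map turns a test function on the extended reals into one on the
  real line. The cut-off at 0 extends the logarithm to negative arguments by the constant
  -\<infinity>.\<close>

lemma log_ext_max_continuous: "continuous_on UNIV (\<lambda>z. log_ext (max z 0))"
proof -
  have "((\<lambda>z. log_ext (max z 0)) \<longlongrightarrow> log_ext (max z 0)) (at z)" for z :: real
  proof (cases "z > 0")
    case True
    then have "((\<lambda>z. ereal (ln z)) \<longlongrightarrow> ereal (ln z)) (at z)"
      by (intro tendsto_intros tendsto_ident_at) auto
    moreover have "\<forall>\<^sub>F y in at z. y > 0" using order_tendstoD(1)[OF tendsto_ident_at True] .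
    then have "\<forall>\<^sub>F y in at z. ereal (ln y) = log_ext (max y 0)"
      by eventually_elim (simp add: log_ext_def)
    ultimately show ?thesis using True by (auto simp: log_ext_def intro: Lim_transform_eventually)
  next
    case False
    \<comment> \<open>Near \<open>z \<le> 0\<close> every \<open>y\<close> lies below
      \<open>exp B\<close>: either \<open>y \<le> 0\<close> and the value is -\<infinity>, or
      \<open>ln y < B\<close>.\<close>
    have "\<forall>\<^sub>F y in at z. log_ext (max y 0) < ereal B" for B
    proof -
      have "z < exp B" using False exp_gt_zero[of B] by linarith
      then have "\<forall>\<^sub>F y in at z. y < exp B" using order_tendstoD(2)[OF tendsto_ident_at] by blast
      then show ?thesis
      proof eventually_elim
        case (elim y)
        then have "y > 0 \<Longrightarrow> ln y < B" using ln_less_cancel_iff[of y "exp B"] by simp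
        then show ?case by (auto simp: log_ext_def max_def)
      qed
    qed
    then show ?thesis using False by (simp add: log_ext_def tendsto_MInfty)
  qed
  then show ?thesis by (simp add: continuous_on_def)
qed

lemma real_distribution_normal_law:
  assumes "s \<ge> 0"
  shows "real_distribution (normal_law \<mu> s)"
  using assms prob_space_normal_density[of "sqrt s" \<mu>]
  by (auto simp: normal_law_def real_distribution_def real_distribution_axioms_def prob_space_return)

text \<open>For \<open>s > 0\<close> the law is an affine image of the standard normal law; the
  point mass at \<open>s = 0\<close> is computed directly.\<close>

lemma char_normal_law:
  assumes "s \<ge> 0"
  shows "char (normal_law \<mu> s) t = exp (\<i> * t * \<mu> - s * t\<^sup>2 / 2)"
proof (cases "s = 0")
  case True
  then show ?thesis by (simp add: normal_law_def char_def integral_return mult.assoc)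
next
  case False
  then have s: "sqrt s > 0" using assms by simp
  interpret N: prob_space std_normal_distribution by (rule prob_space_normal_density) simp
  have "distributed std_normal_distribution lborel (\<lambda>x. x) std_normal_density"
    by (auto simp: distributed_def distr_id2)
  from N.normal_density_affine[OF this, of "sqrt s" \<mu>] s
  have "distributed std_normal_distribution lborel (\<lambda>x. \<mu> + sqrt s * x) (normal_density \<mu> (sqrt s))"
    by simp
  then have "normal_law \<mu> s = distr std_normal_distribution lborel (\<lambda>x. \<mu> + sqrt s * x)"
    using False by (simp add: normal_law_def distributed_def)
  also have "\<dots> = distr std_normal_distribution borel (\<lambda>x. \<mu> + sqrt s * x)"
    by (intro distr_cong) auto
  finally have "char (normal_law \<mu> s) t = (CLINT x|std_normal_distribution. iexp (t * (\<mu> + sqrt s * x)))"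
    by (simp add: char_def integral_distr)
  also have "\<dots> = (CLINT x|std_normal_distribution. iexp (t * \<mu>) * iexp (t * sqrt s * x))"
    by (intro Bochner_Integration.integral_cong) (auto simp: exp_add[symmetric] algebra_simps)
  also have "\<dots> = iexp (t * \<mu>) * char std_normal_distribution (t * sqrt s)"
    by (simp add: char_def mult.assoc)
  also have "\<dots> = exp (\<i> * t * \<mu> - s * t\<^sup>2 / 2)"
    using assms by (simp add: char_std_normal_distribution power_mult_distrib exp_of_real[symmetric] exp_add[symmetric] algebra_simps
                         flip: of_real_power)
  finally show ?thesis .
qed

text \<open>The left term is the power of \<open>1 + x\<close> with exponent
  \<open>\<i> * t\<close>, and the polynomial is its binomial series up to order 2. The constant is
  uniform in unbounded \<open>x\<close> because the third derivative is bounded on the whole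
  half-plane \<open>Re z \<ge> - (1/2)\<close>, which stays away from the branch point.\<close>

lemma iexp_ln_Taylor:
  obtains C where "C \<ge> 0" "\<And>x. x \<ge> - (1/2) \<Longrightarrow>
    cmod (iexp (t * ln (1 + x)) - (1 + \<i> * t * x + \<i> * t * (\<i> * t - 1) / 2 * x\<^sup>2)) \<le> C * \<bar>x\<bar> ^ 3"
proof -
  define w :: complex where "w = \<i> * t"
  \<comment> \<open>\<open>f i\<close> is the i-th derivative of the power function
    \<open>(1 + z) powr w\<close>.\<close>
  define f where "f i z = (\<Prod>j<i. w - of_nat j) * (1 + z) powr (w - of_nat i)" for i and z :: complex
  define S where "S = {z::complex. Re z \<ge> - (1/2)}"
  \<comment> \<open>The term \<open>\<bar>t\<bar> * pi\<close> bounds the contribution of the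
    argument of \<open>1 + z\<close>, and \<open>3 * ln 2\<close> comes from
    \<open>cmod (1 + z) \<ge> 1/2\<close> with exponent -3.\<close>
  define B where "B = cmod (\<Prod>j<3. w - of_nat j) * exp (\<bar>t\<bar> * pi + 3 * ln 2)"
  have B: "cmod (f (Suc 2) z) \<le> B" if "z \<in> S" for z
  proof -
    have "Re (1 + z) \<ge> 1/2" using that by (simp add: S_def)
    moreover from this have "cmod (1 + z) \<ge> 1/2" using complex_Re_le_cmod order_trans by blast
    ultimately have nz: "1 + z \<noteq> 0" and ln: "ln (cmod (1 + z)) \<ge> - ln 2"
      using ln_mono[of "1/2" "cmod (1 + z)"] by (auto simp: ln_div)
    have "\<bar>t * Im (Ln (1 + z))\<bar> \<le> \<bar>t\<bar> * pi"
      unfolding abs_mult using mpi_less_Im_Ln[OF nz] Im_Ln_le_pi[OF nz] by (intro mult_left_mono) auto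
    then have "Re ((w - 3) * Ln (1 + z)) \<le> \<bar>t\<bar> * pi + 3 * ln 2"
      using ln nz by (simp add: w_def algebra_simps)
    then show ?thesis using nz
      by (auto simp: f_def B_def norm_mult powr_def norm_exp_eq_Re intro!: mult_left_mono
               simp del: complex_Re_numeral)
  qed
  have D: "(f i has_field_derivative f (Suc i) z) (at z within S)" if "z \<in> S" for i z
  proof -
    have "Re (1 + z) > 0" using that by (simp add: S_def)
    then have "1 + z \<notin> \<real>\<^sub>\<le>\<^sub>0" by (auto simp: complex_nonpos_Reals_iff)
    then show ?thesis unfolding f_def
      by (auto intro!: derivative_eq_intros DERIV_subset[of _ _ _ UNIV S] simp: algebra_simps)
  qed
  have conv: "convex S" unfolding S_def by (rule convex_halfspace_Re_ge)
  show thesis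
  proof (rule that[of "B / 2"])
    show "B / 2 \<ge> 0" by (simp add: B_def)
    fix x :: real assume x: "x \<ge> - (1/2)"
    have "cmod (f 0 x - (\<Sum>i\<le>2. f i 0 * (complex_of_real x - 0) ^ i / fact i))
        \<le> B * cmod (complex_of_real x - 0) ^ Suc 2 / fact 2"
      using x by (intro field_Taylor[OF conv D B]) (auto simp: S_def)
    moreover have "f 0 x = iexp (t * ln (1 + x))"
    proof -
      have "Ln (1 + complex_of_real x) = complex_of_real (ln (1 + x))"
        using x Ln_of_real[of "1 + x"] by simp
      moreover have "1 + complex_of_real x \<noteq> 0"
        using x of_real_eq_0_iff[of "1 + x", where ?'a = complex] by (simp del: of_real_eq_0_iff)
      ultimately show ?thesis by (simp add: f_def w_def powr_def mult.assoc)
    qed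
    ultimately show "cmod (iexp (t * ln (1 + x)) - (1 + \<i> * t * x + \<i> * t * (\<i> * t - 1) / 2 * x\<^sup>2))
        \<le> B / 2 * \<bar>x\<bar> ^ 3"
      by (simp add: f_def w_def numeral_2_eq_2 numeral_3_eq_3 algebra_simps)
  qed
qed

text \<open>Integrating the Taylor expansion, the linear term vanishes and each factor is
  \<open>1 + z * (p n)\<^sup>2\<close> up to an error of order \<open>(p n) ^ 3\<close>. Since
  \<open>N n * (p n)\<^sup>2\<close> converges, the power may be compared with that of
  \<open>exp (z * (p n)\<^sup>2)\<close>.\<close>

lemma char_power_tendsto_normal:
  fixes \<nu> :: "'b measure" and \<xi> :: "'b \<Rightarrow> real" and N :: "nat \<Rightarrow> nat" and p :: "nat \<Rightarrow> real"
  assumes prob: "prob_space \<nu>" and rv [measurable]: "\<xi> \<in> borel_measurable \<nu>"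
    and ge: "\<And>x. \<xi> x \<ge> - 1"
    and int: "integrable \<nu> \<xi>" "integrable \<nu> (\<lambda>x. (\<xi> x)\<^sup>2)" "integrable \<nu> (\<lambda>x. \<bar>\<xi> x\<bar> ^ 3)"
    and mean: "(\<integral>x. \<xi> x \<partial>\<nu>) = 0" and var: "(\<integral>x. (\<xi> x)\<^sup>2 \<partial>\<nu>) = s"
    and p: "\<And>n. p n \<ge> 0" "p \<longlonglongrightarrow> 0" and Np: "(\<lambda>n. N n * (p n)\<^sup>2) \<longlonglongrightarrow> 2 * \<gamma>" and \<gamma>: "\<gamma> \<ge> 0"
  shows "(\<lambda>n. (CLINT x|\<nu>. iexp (t * ln (1 + p n * \<xi> x))) ^ N n)
    \<longlonglongrightarrow> char (normal_law (- \<gamma> * s) (2 * \<gamma> * s)) t"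
proof -
  interpret prob_space \<nu> by (rule prob)
  have s: "s \<ge> 0" unfolding var[symmetric] by (rule Bochner_Integration.integral_nonneg) simp
  obtain C where C: "C \<ge> 0" "\<And>x. x \<ge> - (1/2) \<Longrightarrow>
    cmod (iexp (t * ln (1 + x)) - (1 + \<i> * t * x + \<i> * t * (\<i> * t - 1) / 2 * x\<^sup>2)) \<le> C * \<bar>x\<bar> ^ 3"
    using iexp_ln_Taylor[of t] by blast
  define w where "w = \<i> * t * (\<i> * t - 1) / 2"
  define z where "z = w * s"
  define \<phi> where "\<phi> n = (CLINT x|\<nu>. iexp (t * ln (1 + p n * \<xi> x)))" for n
  define K where "K = (\<integral>x. \<bar>\<xi> x\<bar> ^ 3 \<partial>\<nu>)"
  \<comment> \<open>This puts \<open>exp (z * (p n)\<^sup>2)\<close> into the closed unit disc, as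
    needed for the bound on differences of powers.\<close>
  have Rez: "Re z \<le> 0"
    using s by (simp add: z_def w_def power2_eq_square algebra_simps mult_nonneg_nonneg)
  have \<phi>_approx: "cmod (\<phi> n - (1 + z * (p n)\<^sup>2)) \<le> C * (p n) ^ 3 * K" if "p n \<le> 1/2" for n
  proof -
    define T where "T x = 1 + \<i> * t * p n * complex_of_real (\<xi> x) + w * (p n)\<^sup>2 * complex_of_real ((\<xi> x)\<^sup>2)" for x
    have i1: "integrable \<nu> (\<lambda>x. iexp (t * ln (1 + p n * \<xi> x)))"
      by (rule integrable_const_bound[where B = 1]) auto
    have i2: "integrable \<nu> (\<lambda>x. complex_of_real (\<xi> x))" "integrable \<nu> (\<lambda>x. complex_of_real ((\<xi> x)\<^sup>2))"
      using int by (auto intro!: integrable_of_real simp del: of_real_power)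
    have iT: "integrable \<nu> T" unfolding T_def
      by (intro Bochner_Integration.integrable_add integrable_mult_right i2 integrable_const)
    have "(CLINT x|\<nu>. T x) = 1 + z * (p n)\<^sup>2"
    proof -
      have "(CLINT x|\<nu>. T x) = 1 + \<i> * t * p n * (CLINT x|\<nu>. complex_of_real (\<xi> x))
          + w * (p n)\<^sup>2 * (CLINT x|\<nu>. complex_of_real ((\<xi> x)\<^sup>2))"
        unfolding T_def using i2 by (simp add: prob_space del: of_real_power)
      then show ?thesis unfolding integral_complex_of_real by (simp add: mean var z_def del: of_real_power)
    qed
    then have "\<phi> n - (1 + z * (p n)\<^sup>2) = (CLINT x|\<nu>. iexp (t * ln (1 + p n * \<xi> x)) - T x)"
      unfolding \<phi>_def Bochner_Integration.integral_diff[OF i1 iT] by metis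
    also have "cmod \<dots> \<le> (\<integral>x. cmod (iexp (t * ln (1 + p n * \<xi> x)) - T x) \<partial>\<nu>)"
      by (rule integral_norm_bound)
    also have "\<dots> \<le> (\<integral>x. C * (p n) ^ 3 * \<bar>\<xi> x\<bar> ^ 3 \<partial>\<nu>)"
    proof (rule integral_mono)
      show "integrable \<nu> (\<lambda>x. cmod (iexp (t * ln (1 + p n * \<xi> x)) - T x))"
        by (rule integrable_norm[OF Bochner_Integration.integrable_diff[OF i1 iT]])
      show "integrable \<nu> (\<lambda>x. C * (p n) ^ 3 * \<bar>\<xi> x\<bar> ^ 3)" using int by simp
      fix x
      have "p n * \<xi> x \<ge> - p n" using mult_left_mono[OF ge[of x] p(1)[of n]] by simp
      \<comment> \<open>The restriction \<open>p n \<le> 1/2\<close> together with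
        \<open>\<xi> \<ge> - 1\<close> keeps the argument in the range of the Taylor bound.\<close>
      then have "p n * \<xi> x \<ge> - (1/2)" using that by linarith
      note C(2)[OF this]
      also have "1 + \<i> * t * complex_of_real (p n * \<xi> x) + \<i> * t * (\<i> * t - 1) / 2 * (p n * \<xi> x)\<^sup>2 = T x"
        by (simp add: T_def w_def power_mult_distrib)
      also have "C * \<bar>p n * \<xi> x\<bar> ^ 3 = C * (p n) ^ 3 * \<bar>\<xi> x\<bar> ^ 3"
        using p(1)[of n] by (simp add: abs_mult power_mult_distrib)
      finally show "cmod (iexp (t * ln (1 + p n * \<xi> x)) - T x) \<le> C * (p n) ^ 3 * \<bar>\<xi> x\<bar> ^ 3" .
    qed
    finally show ?thesis by (simp add: K_def)
  qed
  have \<phi>_le: "cmod (\<phi> n) \<le> 1" for n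
  proof -
    have "cmod (\<phi> n) \<le> (\<integral>x. cmod (iexp (t * ln (1 + p n * \<xi> x))) \<partial>\<nu>)"
      unfolding \<phi>_def by (rule integral_norm_bound)
    then show ?thesis by (simp add: prob_space)
  qed
  have ev: "\<forall>\<^sub>F n in sequentially. p n \<le> 1/2"
    using order_tendstoD(2)[OF p(2), of "1/2"] by (auto elim: eventually_mono)
  \<comment> \<open>In the unit disc N-th powers differ by at most N times the difference of the
    bases. One factor \<open>(p n)\<^sup>2\<close> of that difference is absorbed by
    \<open>N n\<close>, and the remaining ones vanish in the limit.\<close>
  have "\<forall>\<^sub>F n in sequentially. cmod (\<phi> n ^ N n - exp (z * (p n)\<^sup>2) ^ N n)
      \<le> (N n * (p n)\<^sup>2) * (C * p n * K + exp (cmod z * (p n)\<^sup>2) * (cmod z)\<^sup>2 * (p n)\<^sup>2)"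
    using ev
  proof eventually_elim
    case (elim n)
    have "Re z * (p n)\<^sup>2 \<le> 0" using Rez by (simp add: mult_nonpos_nonneg)
    then have "cmod (exp (z * (p n)\<^sup>2)) \<le> 1"
      by (simp add: norm_exp_eq_Re del: of_real_power)
    then have "cmod (\<phi> n ^ N n - exp (z * (p n)\<^sup>2) ^ N n) \<le> N n * cmod (\<phi> n - exp (z * (p n)\<^sup>2))"
      by (intro norm_power_diff \<phi>_le)
    also have "cmod (\<phi> n - exp (z * (p n)\<^sup>2))
        \<le> cmod (\<phi> n - (1 + z * (p n)\<^sup>2)) + cmod (exp (z * (p n)\<^sup>2) - (1 + z * (p n)\<^sup>2))"
      using norm_triangle_ineq4[of "\<phi> n - (1 + z * (p n)\<^sup>2)" "exp (z * (p n)\<^sup>2) - (1 + z * (p n)\<^sup>2)"] by simp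
    also have "cmod (exp (z * (p n)\<^sup>2) - (1 + z * (p n)\<^sup>2)) \<le> exp (cmod z * (p n)\<^sup>2) * (cmod z * (p n)\<^sup>2)\<^sup>2"
      using Taylor_exp_field[of "z * (p n)\<^sup>2" 1] by (simp add: norm_mult norm_power power2_eq_square)
    also note \<phi>_approx[OF elim]
    finally have "cmod (\<phi> n ^ N n - exp (z * (p n)\<^sup>2) ^ N n)
        \<le> N n * (C * (p n) ^ 3 * K + exp (cmod z * (p n)\<^sup>2) * (cmod z * (p n)\<^sup>2)\<^sup>2)"
      by (simp add: mult_left_mono)
    then show ?case by (simp add: algebra_simps power2_eq_square power3_eq_cube)
  qed
  moreover have "(\<lambda>n. (N n * (p n)\<^sup>2) * (C * p n * K + exp (cmod z * (p n)\<^sup>2) * (cmod z)\<^sup>2 * (p n)\<^sup>2)) \<longlonglongrightarrow> 0"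
    by (rule tendsto_eq_intros Np p | simp)+
  ultimately have "(\<lambda>n. \<phi> n ^ N n - exp (z * (p n)\<^sup>2) ^ N n) \<longlonglongrightarrow> 0"
    by (rule Lim_null_comparison)
  moreover have "(\<lambda>n. exp (z * (p n)\<^sup>2) ^ N n) \<longlonglongrightarrow> exp (z * (2 * \<gamma>))"
  proof -
    have "(\<lambda>n. exp (z * complex_of_real (N n * (p n)\<^sup>2))) \<longlonglongrightarrow> exp (z * complex_of_real (2 * \<gamma>))"
      by (intro tendsto_intros Np)
    then show ?thesis by (simp add: exp_of_nat_mult[symmetric] mult.left_commute)
  qed
  ultimately have "(\<lambda>n. \<phi> n ^ N n) \<longlonglongrightarrow> exp (z * (2 * \<gamma>))"
    using tendsto_add by fastforce
  moreover have "exp (z * (2 * \<gamma>)) = char (normal_law (- \<gamma> * s) (2 * \<gamma> * s)) t"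
  proof -
    \<comment> \<open>Expanding \<open>\<i> * t * (\<i> * t - 1)\<close> gives the mean from its
      linear and the variance from its quadratic part in \<open>t\<close>.\<close>
    have "z * (2 * \<gamma>) = \<i> * t * complex_of_real (- \<gamma> * s) - complex_of_real (2 * \<gamma> * s * t\<^sup>2 / 2)"
      by (simp add: z_def w_def power2_eq_square field_simps)
    then show ?thesis using s \<gamma> by (subst char_normal_law) auto
  qed
  ultimately show ?thesis by (simp add: \<phi>_def)
qed

text \<open>Every factor is at least \<open>1 - p > 0\<close>, so the logarithm of the product is a
  sum of independent variables with equal laws, and characteristic functions multiply.\<close>

lemma (in prob_space) char_ln_prod:
  fixes X :: "'b \<Rightarrow> 'a \<Rightarrow> 'c::{second_countable_topology, t2_space}" and \<xi> :: "'c \<Rightarrow> real"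
  assumes fin: "finite E" and indep: "indep_vars (\<lambda>_. borel) X E"
    and law: "\<And>e. e \<in> E \<Longrightarrow> distr M borel (X e) = \<nu>"
    and [measurable]: "\<xi> \<in> borel_measurable borel" and ge: "\<And>x. \<xi> x \<ge> - 1" and p: "0 \<le> p" "p < 1"
  shows "char (distr M borel (\<lambda>x. ln (\<Prod>e\<in>E. 1 + p * \<xi> (X e x)))) t
    = (CLINT x|\<nu>. iexp (t * ln (1 + p * \<xi> x))) ^ card E"
proof -
  have X [measurable]: "e \<in> E \<Longrightarrow> X e \<in> borel_measurable M" for e
    using indep by (auto simp: indep_vars_def)
  have pos: "1 + p * \<xi> y > 0" for y
  proof -
    have "p * \<xi> y \<ge> - p" using mult_left_mono[OF ge[of y] p(1)] by simp
    then show ?thesis using p by linarith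
  qed
  have "(\<lambda>x. ln (\<Prod>e\<in>E. 1 + p * \<xi> (X e x))) = (\<lambda>x. \<Sum>e\<in>E. ln (1 + p * \<xi> (X e x)))"
    using fin pos by (intro ext ln_prod) (auto simp: less_imp_neq[THEN not_sym])
  moreover have "indep_vars (\<lambda>_. borel) (\<lambda>e x. ln (1 + p * \<xi> (X e x))) E"
    by (rule indep_vars_compose2[OF indep]) measurable
  ultimately have "char (distr M borel (\<lambda>x. ln (\<Prod>e\<in>E. 1 + p * \<xi> (X e x)))) t
      = (\<Prod>e\<in>E. char (distr M borel (\<lambda>x. ln (1 + p * \<xi> (X e x)))) t)"
    by (simp add: char_distr_sum)
  also have "\<dots> = (\<Prod>e\<in>E. CLINT x|\<nu>. iexp (t * ln (1 + p * \<xi> x)))"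
  proof (intro prod.cong refl)
    fix e assume e: "e \<in> E"
    have [measurable]: "X e \<in> borel_measurable M" using X e .
    show "char (distr M borel (\<lambda>x. ln (1 + p * \<xi> (X e x)))) t = (CLINT x|\<nu>. iexp (t * ln (1 + p * \<xi> x)))"
      unfolding law[OF e, symmetric] char_def by (simp add: integral_distr)
  qed
  finally show ?thesis by simp
qed

text \<open>Slutsky's lemma in a form that avoids convergence in probability: an \<open>L\<^sup>1\<close>-small
  perturbation does not change the limit of the characteristic functions.\<close>

lemma expectation_tendsto_of_char_ln:
  fixes M :: "nat \<Rightarrow> 'w measure" and X Y :: "nat \<Rightarrow> 'w \<Rightarrow> real" and g :: "real \<Rightarrow> real"
  assumes prob: "\<And>n. prob_space (M n)" and G: "real_distribution G"
    and X [measurable]: "\<And>n. X n \<in> borel_measurable (M n)"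
    and Y [measurable]: "\<And>n. Y n \<in> borel_measurable (M n)"
    and pos: "\<forall>\<^sub>F n in sequentially. \<forall>x. Y n x > 0"
    and char_lim: "\<And>t. (\<lambda>n. char (distr (M n) borel (\<lambda>x. ln (Y n x))) t) \<longlonglongrightarrow> char G t"
    and int: "\<And>n. integrable (M n) (\<lambda>x. X n x - Y n x)"
    and L1: "(\<lambda>n. \<integral>x. \<bar>X n x - Y n x\<bar> \<partial>M n) \<longlonglongrightarrow> 0"
    and g: "continuous_on UNIV g" "bounded (range g)"
  shows "(\<lambda>n. \<integral>x. g (X n x) \<partial>M n) \<longlonglongrightarrow> (\<integral>x. g (exp x) \<partial>G)"
proof -
  interpret G: real_distribution G by (rule G)
  have rd: "real_distribution (distr (M n) borel f)" if "f \<in> borel_measurable (M n)" for n f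
    using prob_space.real_distribution_distr[OF prob that] .
  have wc_ln: "weak_conv_m (\<lambda>n. distr (M n) borel (\<lambda>x. ln (Y n x))) G"
    by (intro levy_continuity G char_lim rd) measurable
  have char_X: "(\<lambda>n. char (distr (M n) borel (X n)) t) \<longlonglongrightarrow> char (distr G borel exp) t" for t
  proof -
    \<comment> \<open>The bounded continuous function \<open>x \<mapsto> iexp (t * exp x)\<close>
      passes from the law of \<open>ln Y\<close> to the characteristic function of \<open>Y\<close>.
      Thus \<open>X\<close>, which may vanish, is compared with \<open>Y\<close> without taking its
      logarithm.\<close>
    have "(\<lambda>n. CLINT x|distr (M n) borel (\<lambda>x. ln (Y n x)). iexp (t * exp x)) \<longlonglongrightarrow> (CLINT x|G. iexp (t * exp x))"
      by (rule weak_conv_imp_integral_bdd_continuous_conv[OF rd G wc_ln, where B = 1])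
         (auto intro!: continuous_intros)
    \<comment> \<open>Positivity of \<open>Y\<close> enters here, through
      \<open>exp (ln Y) = Y\<close>.\<close>
    moreover have "\<forall>\<^sub>F n in sequentially. (CLINT x|distr (M n) borel (\<lambda>x. ln (Y n x)). iexp (t * exp x))
        = char (distr (M n) borel (Y n)) t"
      using pos by eventually_elim (simp add: char_def integral_distr)
    ultimately have "(\<lambda>n. char (distr (M n) borel (Y n)) t) \<longlonglongrightarrow> (CLINT x|G. iexp (t * exp x))"
      by (rule Lim_transform_eventually)
    then have "(\<lambda>n. char (distr (M n) borel (Y n)) t) \<longlonglongrightarrow> char (distr G borel exp) t"
      by (simp add: char_def integral_distr)
    moreover have "(\<lambda>n. char (distr (M n) borel (X n)) t - char (distr (M n) borel (Y n)) t) \<longlonglongrightarrow> 0"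
    proof (rule Lim_null_comparison[OF always_eventually])
      show "\<forall>n. cmod (char (distr (M n) borel (X n)) t - char (distr (M n) borel (Y n)) t)
          \<le> \<bar>t\<bar> * (\<integral>x. \<bar>X n x - Y n x\<bar> \<partial>M n)"
        by (intro allI prob_space.char_distr_diff_le prob X Y int)
      show "(\<lambda>n. \<bar>t\<bar> * (\<integral>x. \<bar>X n x - Y n x\<bar> \<partial>M n)) \<longlonglongrightarrow> 0"
        using tendsto_mult_left[OF L1] by simp
    qed
    ultimately show ?thesis using tendsto_add by fastforce
  qed
  have rdE: "real_distribution (distr G borel exp)" by (rule G.real_distribution_distr) simp
  have wc: "weak_conv_m (\<lambda>n. distr (M n) borel (X n)) (distr G borel exp)"
    by (intro levy_continuity rdE char_X rd X)
  from g(2) obtain B where "\<And>x. norm (g x) \<le> B" by (auto simp: bounded_iff)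
  moreover have "isCont g x" for x using g(1) by (simp add: continuous_on_eq_continuous_at)
  moreover have [measurable]: "g \<in> borel_measurable borel" using g(1) by (rule borel_measurable_continuous_onI)
  ultimately have "(\<lambda>n. \<integral>x. g x \<partial>distr (M n) borel (X n)) \<longlonglongrightarrow> (\<integral>x. g x \<partial>distr G borel exp)"
    using weak_conv_imp_integral_bdd_continuous_conv[OF rd[OF X] rdE wc] by blast
  then show ?thesis by (simp add: integral_distr)
qed

section \<open>The partition function\<close>

text \<open>The value -\<infinity> must be excluded: there \<open>exp_weight\<close> has the dummy
  value 1, which breaks multiplicativity.\<close>

lemma exp_weight_add:
  assumes "x \<noteq> -\<infinity>" "y \<noteq> -\<infinity>"
  shows "exp_weight \<beta> (x + y) = exp_weight \<beta> x * exp_weight \<beta> y"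
  using assms by (cases x; cases y) (auto simp: exp_weight_def exp_add[symmetric] algebra_simps)

lemma sum_ereal_not_MInfty:
  fixes w :: "'b \<Rightarrow> ereal"
  assumes "\<And>e. e \<in> A \<Longrightarrow> w e \<noteq> -\<infinity>"
  shows "(\<Sum>e\<in>A. w e) \<noteq> -\<infinity>"
  using assms by (induction A rule: infinite_finite_induct) auto

lemma exp_weight_sum:
  assumes "finite A" "\<And>e. e \<in> A \<Longrightarrow> w e \<noteq> -\<infinity>"
  shows "exp_weight \<beta> (\<Sum>e\<in>A. w e) = (\<Prod>e\<in>A. exp_weight \<beta> (w e))"
  using assms
proof (induction A rule: finite_induct)
  case empty
  then show ?case by (simp add: exp_weight_def)
next
  case (insert e A)
  have "(\<Sum>e\<in>A. w e) \<noteq> -\<infinity>"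
    using insert.prems by (intro sum_ereal_not_MInfty) auto
  then show ?case using insert by (simp add: exp_weight_add)
qed

lemma exp_weight_nonneg: "exp_weight \<beta> x \<ge> 0"
  by (simp add: exp_weight_def)

text \<open>The case \<open>k = 0\<close> is separate because
  \<open>exp_weight 0 \<infinity> = 0\<close> whereas \<open>0 ^ 0 = 1\<close>.\<close>

lemma exp_weight_power: "exp_weight \<beta> x ^ k = (if k = 0 then 1 else exp_weight (k * \<beta>) x)"
  by (simp add: exp_weight_def exp_of_nat_mult[symmetric] mult.assoc)

lemma exp_weight_measurable [measurable]: "exp_weight \<beta> \<in> borel_measurable borel"
  unfolding exp_weight_def[abs_def] by measurable

lemma log_ext_measurable [measurable]: "log_ext \<in> borel_measurable borel"
  unfolding log_ext_def[abs_def] by measurable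

lemma P0_eq_card:
  assumes "finite S" "S \<noteq> {}"
  shows "P0 S A = card {\<pi>\<in>S. A \<pi>} / card S"
proof -
  have "{\<pi>\<in>S. A \<pi>} = S \<inter> {\<pi>. A \<pi>}" by auto
  then show ?thesis using assms by (simp add: P0_def measure_pmf_of_set)
qed

text \<open>Expand each product over the subsets of \<pi> and exchange the sums: the monomial of
  \<Gamma> is met once for every \<pi> that contains \<Gamma>.\<close>

lemma average_prod_one_plus:
  fixes z :: "'a set \<Rightarrow> real"
  assumes "finite E" "S \<subseteq> Pow E" "S \<noteq> {}"
  shows "(\<Sum>\<pi>\<in>S. \<Prod>e\<in>\<pi>. 1 + z e) / card S = (\<Sum>\<Gamma>\<in>Pow E. P0 S (\<lambda>\<pi>. \<Gamma> \<subseteq> \<pi>) * (\<Prod>e\<in>\<Gamma>. z e))"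
proof -
  have fS: "finite S" using assms finite_subset by auto
  have "(\<Prod>e\<in>\<pi>. 1 + z e) = (\<Sum>\<Gamma>\<in>Pow E. if \<Gamma> \<subseteq> \<pi> then (\<Prod>e\<in>\<Gamma>. z e) else 0)" if "\<pi> \<in> S" for \<pi>
  proof -
    have \<pi>: "\<pi> \<subseteq> E" "finite \<pi>" using that assms by (auto intro: finite_subset[of _ E])
    have "(\<Prod>e\<in>\<pi>. 1 + z e) = (\<Sum>\<Gamma>\<in>Pow \<pi>. \<Prod>e\<in>\<Gamma>. z e)"
      using prod_add[OF \<pi>(2), of z "\<lambda>_. 1"] by (simp add: add.commute)
    also have "\<dots> = (\<Sum>\<Gamma>\<in>Pow E. if \<Gamma> \<subseteq> \<pi> then (\<Prod>e\<in>\<Gamma>. z e) else 0)"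
      using \<pi> assms(1) by (intro sum.mono_neutral_cong_left) auto
    finally show ?thesis .
  qed
  then have "(\<Sum>\<pi>\<in>S. \<Prod>e\<in>\<pi>. 1 + z e) = (\<Sum>\<pi>\<in>S. \<Sum>\<Gamma>\<in>Pow E. if \<Gamma> \<subseteq> \<pi> then (\<Prod>e\<in>\<Gamma>. z e) else 0)"
    by simp
  also have "\<dots> = (\<Sum>\<Gamma>\<in>Pow E. \<Sum>\<pi>\<in>S. if \<Gamma> \<subseteq> \<pi> then (\<Prod>e\<in>\<Gamma>. z e) else 0)"
    by (rule sum.swap)
  also have "\<dots> = (\<Sum>\<Gamma>\<in>Pow E. card {\<pi>\<in>S. \<Gamma> \<subseteq> \<pi>} * (\<Prod>e\<in>\<Gamma>. z e))"
    using fS by (simp add: sum.inter_filter[symmetric])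
  finally show ?thesis
    by (simp add: sum_divide_distrib P0_eq_card[OF fS assms(3)])
qed

lemma prod_one_plus_mult:
  fixes z :: "'b \<Rightarrow> real"
  assumes "finite E"
  shows "(\<Prod>e\<in>E. 1 + p * z e) = (\<Sum>\<Gamma>\<in>Pow E. p ^ card \<Gamma> * (\<Prod>e\<in>\<Gamma>. z e))"
  using prod_add[OF assms, of "\<lambda>e. p * z e" "\<lambda>_. 1"] by (simp add: add.commute prod.distrib)

text \<open>All elements of \<open>S\<close> have \<open>m\<close> edges, so normalising every edge
  factor by \<open>exp c\<close> takes the same constant \<open>exp (m * c)\<close> out of each
  term. If the normalised sum is 0, both sides are -\<infinity>.\<close>

lemma log_ext_partition_function:
  assumes fin: "finite E" and sub: "S \<subseteq> Pow E" and card: "\<And>\<pi>. \<pi> \<in> S \<Longrightarrow> card \<pi> = m"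
    and w: "\<And>e. e \<in> E \<Longrightarrow> w e \<noteq> -\<infinity>"
  shows "log_ext (partition_function S w \<beta>) - ereal (m * c)
    = log_ext ((\<Sum>\<pi>\<in>S. \<Prod>e\<in>\<pi>. exp_weight \<beta> (w e) / exp c) / card S)"
proof -
  have "exp_weight \<beta> (total_weight w \<pi>) = exp (m * c) * (\<Prod>e\<in>\<pi>. exp_weight \<beta> (w e) / exp c)" if "\<pi> \<in> S" for \<pi>
  proof -
    have \<pi>: "\<pi> \<subseteq> E" "finite \<pi>" using that sub fin by (auto intro: finite_subset[of _ E])
    then have "exp_weight \<beta> (total_weight w \<pi>) = (\<Prod>e\<in>\<pi>. exp_weight \<beta> (w e))"
      unfolding total_weight_def using w by (intro exp_weight_sum) auto
    then show ?thesis using card[OF that] by (simp add: prod_dividef exp_of_nat_mult)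
  qed
  moreover define z where "z = (\<Sum>\<pi>\<in>S. \<Prod>e\<in>\<pi>. exp_weight \<beta> (w e) / exp c) / card S"
  ultimately have eq: "partition_function S w \<beta> = exp (m * c) * z"
    by (simp add: partition_function_def sum_distrib_left[symmetric])
  have "z \<ge> 0"
    unfolding z_def by (intro divide_nonneg_nonneg sum_nonneg prod_nonneg) (auto simp: exp_weight_nonneg)
  then have "log_ext (exp (m * c) * z) - ereal (m * c) = log_ext z"
    by (auto simp: log_ext_def ln_mult)
  then show ?thesis unfolding eq z_def .
qed

text \<open>For matchings the relative error is multiplied by \<open>p ^ card \<Gamma>\<close>. For
  other sets both numbers lie between 0 and \<open>(R * p) ^ card \<Gamma>\<close>, hence so does
  the modulus of their difference; \<open>R \<ge> 1\<close> serves the term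
  \<open>p ^ card \<Gamma>\<close>.\<close>

lemma coefficient_error:
  fixes p \<rho>1 \<rho>2 R \<delta> :: real
  assumes S: "finite S" "S \<noteq> {}" and p: "p > 0" and R: "R \<ge> 1" "R \<ge> \<rho>1" "R \<ge> \<rho>2" "\<rho>1 > 0" "\<rho>2 > 0"
    and edge: "\<And>e. e \<in> E \<Longrightarrow> P0 S (\<lambda>\<pi>. e \<in> \<pi>) = p" and \<delta>: "\<delta> \<ge> 0"
    and matching: "\<And>\<Gamma>. partial_matching E \<Gamma> \<Longrightarrow>
      \<bar>P0 S (\<lambda>\<pi>. \<Gamma> \<subseteq> \<pi>) / (\<Prod>e\<in>\<Gamma>. P0 S (\<lambda>\<pi>. e \<in> \<pi>)) - 1\<bar> \<le> \<rho>1 ^ card \<Gamma> * \<delta>"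
    and nonmatching: "\<And>\<Gamma>. \<Gamma> \<in> subset_closure S \<Longrightarrow> \<not> partial_matching E \<Gamma> \<Longrightarrow>
      P0 S (\<lambda>\<pi>. \<Gamma> \<subseteq> \<pi>) \<le> \<rho>2 ^ card \<Gamma> * (\<Prod>e\<in>\<Gamma>. P0 S (\<lambda>\<pi>. e \<in> \<pi>))"
  shows "partial_matching E \<Gamma> \<Longrightarrow> \<bar>P0 S (\<lambda>\<pi>. \<Gamma> \<subseteq> \<pi>) - p ^ card \<Gamma>\<bar> \<le> \<delta> * (R * p) ^ card \<Gamma>"
    and "\<Gamma> \<subseteq> E \<Longrightarrow> \<not> partial_matching E \<Gamma> \<Longrightarrow> \<bar>P0 S (\<lambda>\<pi>. \<Gamma> \<subseteq> \<pi>) - p ^ card \<Gamma>\<bar> \<le> (R * p) ^ card \<Gamma>"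
proof -
  have prod: "(\<Prod>e\<in>\<Gamma>. P0 S (\<lambda>\<pi>. e \<in> \<pi>)) = p ^ card \<Gamma>" if "\<Gamma> \<subseteq> E" for \<Gamma>
    using that edge by (simp add: subset_iff)
  have le: "r ^ card \<Gamma> * p ^ card \<Gamma> \<le> (R * p) ^ card \<Gamma>" if "0 \<le> r" "r \<le> R" for r
    using that p by (simp add: power_mult_distrib mult_right_mono power_mono)
  {
    assume m: "partial_matching E \<Gamma>"
    then have "\<Gamma> \<subseteq> E" by (simp add: partial_matching_def)
    with matching[OF m] have "\<bar>P0 S (\<lambda>\<pi>. \<Gamma> \<subseteq> \<pi>) / p ^ card \<Gamma> - 1\<bar> \<le> \<rho>1 ^ card \<Gamma> * \<delta>"
      by (simp add: prod)
    then have "\<bar>P0 S (\<lambda>\<pi>. \<Gamma> \<subseteq> \<pi>) / p ^ card \<Gamma> - 1\<bar> * p ^ card \<Gamma> \<le> (\<rho>1 ^ card \<Gamma> * \<delta>) * p ^ card \<Gamma>"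
      using p by (intro mult_right_mono) auto
    also have "\<bar>P0 S (\<lambda>\<pi>. \<Gamma> \<subseteq> \<pi>) / p ^ card \<Gamma> - 1\<bar> * p ^ card \<Gamma> = \<bar>P0 S (\<lambda>\<pi>. \<Gamma> \<subseteq> \<pi>) - p ^ card \<Gamma>\<bar>"
      using p abs_mult_pos[of "p ^ card \<Gamma>" "P0 S (\<lambda>\<pi>. \<Gamma> \<subseteq> \<pi>) / p ^ card \<Gamma> - 1"]
      by (simp add: left_diff_distrib)
    also have "(\<rho>1 ^ card \<Gamma> * \<delta>) * p ^ card \<Gamma> = \<delta> * (\<rho>1 ^ card \<Gamma> * p ^ card \<Gamma>)" by simp
    also have "\<dots> \<le> \<delta> * (R * p) ^ card \<Gamma>" using R \<delta> by (intro mult_left_mono le) auto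
    finally show "\<bar>P0 S (\<lambda>\<pi>. \<Gamma> \<subseteq> \<pi>) - p ^ card \<Gamma>\<bar> \<le> \<delta> * (R * p) ^ card \<Gamma>" .
  }
  {
    assume m: "\<Gamma> \<subseteq> E" "\<not> partial_matching E \<Gamma>"
    have "0 \<le> P0 S (\<lambda>\<pi>. \<Gamma> \<subseteq> \<pi>)" by (simp add: P0_def)
    moreover have "P0 S (\<lambda>\<pi>. \<Gamma> \<subseteq> \<pi>) \<le> (R * p) ^ card \<Gamma>"
    proof (cases "\<Gamma> \<in> subset_closure S")
      case True
      from nonmatching[OF this m(2)] le[of \<rho>2] R show ?thesis by (simp add: prod[OF m(1)])
    next
      case False
      \<comment> \<open>A set outside the closure is contained in no \<pi>, so its probability is
        0.\<close>
      then have empty: "{\<pi>\<in>S. \<Gamma> \<subseteq> \<pi>} = {}" by (auto simp: subset_closure_def)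
      show ?thesis using R p unfolding P0_eq_card[OF S] empty by simp
    qed
    moreover have "0 \<le> p ^ card \<Gamma>" "p ^ card \<Gamma> \<le> (R * p) ^ card \<Gamma>" using le[of 1] R p by auto
    ultimately show "\<bar>P0 S (\<lambda>\<pi>. \<Gamma> \<subseteq> \<pi>) - p ^ card \<Gamma>\<bar> \<le> (R * p) ^ card \<Gamma>" by linarith
  }
qed

section \<open>Asymptotics of the edge density and of the L1 error\<close>

lemma density_asymptotics:
  fixes N v m :: "nat \<Rightarrow> nat" and c :: nat and \<gamma> :: real and p :: "nat \<Rightarrow> real"
  defines "p \<equiv> \<lambda>n. real (m n) / real (N n)"
  assumes v: "\<And>n. n \<ge> 1 \<Longrightarrow> v n = c * n"
    and N: "(\<lambda>n. real (N n)) \<in> \<Theta>(\<lambda>n. real (v n) ^ 2)"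
    and \<gamma>: "\<gamma> > 0" and lim: "(\<lambda>n. real (m n) ^ 2 / (2 * real (N n))) \<longlonglongrightarrow> \<gamma>"
  shows "(\<lambda>n. N n * (p n)\<^sup>2) \<longlonglongrightarrow> 2 * \<gamma>" "p \<longlonglongrightarrow> 0" "(\<lambda>n. 1 / real (m n)) \<longlonglongrightarrow> 0"
    "(\<lambda>n. real (v n) / N n) \<longlonglongrightarrow> 0" "\<forall>\<^sub>F n in sequentially. p n > 0"
proof -
  have lim2: "(\<lambda>n. real (m n) ^ 2 / N n) \<longlonglongrightarrow> 2 * \<gamma>"
    using tendsto_mult_left[OF lim, of 2] by simp
  have Np_eq: "real (N n) * (p n)\<^sup>2 = real (m n) ^ 2 / N n" for n
    by (simp add: p_def power2_eq_square)
  show Np: "(\<lambda>n. N n * (p n)\<^sup>2) \<longlonglongrightarrow> 2 * \<gamma>"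
    unfolding Np_eq by (rule lim2)
  have pos: "\<forall>\<^sub>F n in sequentially. real (m n) ^ 2 / N n > 0"
    using order_tendstoD(1)[OF lim2, of 0] \<gamma> by simp
  then show "\<forall>\<^sub>F n in sequentially. p n > 0"
    by eventually_elim (auto simp: p_def zero_less_divide_iff)
  obtain C :: real where C: "C > 0" "\<forall>\<^sub>F n in sequentially. real (v n) ^ 2 \<le> C * N n"
    using bigthetaD2[OF N] by (auto simp: bigomega_iff_bigo elim!: landau_o.bigE)
  obtain D :: real where D: "\<forall>\<^sub>F n in sequentially. real (N n) \<le> D * real (v n) ^ 2"
    using bigthetaD1[OF N] by (auto elim!: landau_o.bigE)
  \<comment> \<open>If \<open>c = 0\<close>, the upper bound forces \<open>N n = 0\<close>, and then
    the quotient \<open>m\<^sup>2 / N\<close> is 0 by the convention for division, against its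
    positive limit.\<close>
  have c: "c > 0"
  proof (rule ccontr)
    assume "\<not> c > 0"
    have "\<forall>\<^sub>F n in sequentially. False"
      using eventually_conj[OF eventually_conj[OF D pos] eventually_ge_at_top[of 1]]
      by (rule eventually_mono) (use \<open>\<not> c > 0\<close> v in auto)
    then show False by simp
  qed
  have vinf: "(\<lambda>n. C / real (v n)) \<longlonglongrightarrow> 0"
  proof (rule Lim_transform_eventually)
    show "(\<lambda>n. C / real c * (1 / real n)) \<longlonglongrightarrow> 0"
      using tendsto_mult_left[OF lim_1_over_n, of "C / real c"] by simp
    show "\<forall>\<^sub>F n in sequentially. C / real c * (1 / real n) = C / real (v n)"
      using eventually_ge_at_top[of 1] by eventually_elim (simp add: v)
  qed
  \<comment> \<open>Divide \<open>v\<^sup>2 \<le> C * N\<close> by \<open>v * N\<close>; the bound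
    \<open>1 \<le> v\<close> later gives the decay of \<open>1 / N\<close>.\<close>
  have vN: "\<forall>\<^sub>F n in sequentially. 1 \<le> real (v n) \<and> real (v n) / N n \<le> C / real (v n)"
    using C(2) pos eventually_ge_at_top[of 1]
  proof eventually_elim
    case (elim n)
    then have "v n \<ge> 1" "N n > 0" using c by (auto simp: v Suc_le_eq intro!: Nat.gr0I)
    then show ?case using elim(1) by (simp add: field_simps power2_eq_square)
  qed
  show "(\<lambda>n. real (v n) / N n) \<longlonglongrightarrow> 0"
    by (rule tendsto_sandwich[OF _ _ tendsto_const vinf]) (use vN in \<open>auto elim: eventually_mono\<close>)
  have Ninv: "(\<lambda>n. 1 / real (N n)) \<longlonglongrightarrow> 0"
  proof (rule tendsto_sandwich[OF _ _ tendsto_const vinf])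
    show "\<forall>\<^sub>F n in sequentially. 1 / real (N n) \<le> C / real (v n)"
      using vN
    proof eventually_elim
      case (elim n)
      then have "1 / real (N n) \<le> real (v n) / N n" by (intro divide_right_mono) auto
      then show ?case using elim by linarith
    qed
  qed auto
  \<comment> \<open>The square of \<open>p\<close> is \<open>m\<^sup>2 / N\<close>, which converges,
    times \<open>1 / N\<close>, which vanishes.\<close>
  have "(\<lambda>n. sqrt (real (m n) ^ 2 / N n * (1 / N n))) \<longlonglongrightarrow> sqrt (2 * \<gamma> * 0)"
    by (intro tendsto_intros lim2 Ninv)
  moreover have "sqrt (real (m n) ^ 2 / N n * (1 / N n)) = p n" for n
    by (simp add: p_def real_sqrt_divide real_sqrt_mult)
  ultimately show p0: "p \<longlonglongrightarrow> 0" by simp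
  have "(\<lambda>n. p n / (real (m n) ^ 2 / N n)) \<longlonglongrightarrow> 0 / (2 * \<gamma>)"
    using \<gamma> by (intro tendsto_intros p0 lim2) auto
  moreover have "\<forall>\<^sub>F n in sequentially. p n / (real (m n) ^ 2 / N n) = 1 / real (m n)"
    using pos by eventually_elim (auto simp: p_def power2_eq_square zero_less_divide_iff)
  ultimately show "(\<lambda>n. 1 / real (m n)) \<longlonglongrightarrow> 0"
    by (simp add: Lim_transform_eventually)
qed

text \<open>Both terms of \<open>D\<close> are polynomials in the same monomials, so
  \<open>D\<close> is a chaos whose coefficients are the differences; its L1 norm is at most its L2
  norm.\<close>

lemma (in prob_space) L1_distance_le:
  fixes \<zeta> :: "'b set \<Rightarrow> 'a \<Rightarrow> real" and p s :: real
  assumes fin: "finite E" and S: "S \<subseteq> Pow E" "S \<noteq> {}"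
    and indep: "indep_vars (\<lambda>_. borel) \<zeta> E"
    and int: "\<And>e. e \<in> E \<Longrightarrow> integrable M (\<zeta> e)" and int2: "\<And>e. e \<in> E \<Longrightarrow> integrable M (\<lambda>x. (\<zeta> e x)\<^sup>2)"
    and mean: "\<And>e. e \<in> E \<Longrightarrow> expectation (\<zeta> e) = 0"
    and var: "\<And>e. e \<in> E \<Longrightarrow> expectation (\<lambda>x. (\<zeta> e x)\<^sup>2) = s"
  defines "D x \<equiv> (\<Sum>\<pi>\<in>S. \<Prod>e\<in>\<pi>. 1 + \<zeta> e x) / card S - (\<Prod>e\<in>E. 1 + p * \<zeta> e x)"
  shows "integrable M D"
    and "expectation (\<lambda>x. \<bar>D x\<bar>) \<le> sqrt (\<Sum>\<Gamma>\<in>Pow E. (P0 S (\<lambda>\<pi>. \<Gamma> \<subseteq> \<pi>) - p ^ card \<Gamma>)\<^sup>2 * s ^ card \<Gamma>)"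
proof -
  have D: "D x = (\<Sum>\<Gamma>\<in>Pow E. (P0 S (\<lambda>\<pi>. \<Gamma> \<subseteq> \<pi>) - p ^ card \<Gamma>) * (\<Prod>e\<in>\<Gamma>. \<zeta> e x))" for x
    unfolding D_def average_prod_one_plus[OF fin S] prod_one_plus_mult[OF fin]
    by (simp add: sum_subtractf left_diff_distrib)
  have [measurable]: "D \<in> borel_measurable M"
    unfolding D[abs_def] using int by (intro borel_measurable_sum borel_measurable_times borel_measurable_prod) auto
  note chaos = polynomial_chaos_second_moment[OF fin indep int int2 mean var,
      of "\<lambda>\<Gamma>. P0 S (\<lambda>\<pi>. \<Gamma> \<subseteq> \<pi>) - p ^ card \<Gamma>", folded D]
  show "integrable M D" using expectation_abs_le_sqrt(1)[of D] chaos(1) by simp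
  show "expectation (\<lambda>x. \<bar>D x\<bar>) \<le> sqrt (\<Sum>\<Gamma>\<in>Pow E. (P0 S (\<lambda>\<pi>. \<Gamma> \<subseteq> \<pi>) - p ^ card \<Gamma>)\<^sup>2 * s ^ card \<Gamma>)"
    using expectation_abs_le_sqrt(2)[of D] chaos by simp
qed

text \<open>\<open>N * a\<close> converges, the first summand is \<open>1 / m\<close>, and the
  second is \<open>2 * (v / N) * (N * a)\<^sup>2\<close>.\<close>

lemma L1_bound_tendsto_0:
  fixes N v m :: "nat \<Rightarrow> nat" and p a :: "nat \<Rightarrow> real" and R s \<gamma> :: real
  assumes Np: "(\<lambda>n. N n * (p n)\<^sup>2) \<longlonglongrightarrow> 2 * \<gamma>" and minv: "(\<lambda>n. 1 / real (m n)) \<longlonglongrightarrow> 0"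
    and vN: "(\<lambda>n. real (v n) / N n) \<longlonglongrightarrow> 0" and pos: "\<forall>\<^sub>F n in sequentially. p n > 0 \<and> N n > 0"
  defines "a \<equiv> \<lambda>n. (R * p n)\<^sup>2 * s"
  shows "(\<lambda>n. sqrt (((1 / sqrt (real (m n)))\<^sup>2 + 2 * v n * N n * (a n)\<^sup>2) * exp (N n * a n))) \<longlonglongrightarrow> 0"
proof -
  have Na: "(\<lambda>n. N n * a n) \<longlonglongrightarrow> R\<^sup>2 * s * (2 * \<gamma>)"
    using tendsto_mult_left[OF Np, of "R\<^sup>2 * s"] by (simp add: a_def power_mult_distrib mult_ac)
  have "(\<lambda>n. 2 * (real (v n) / N n) * (N n * a n)\<^sup>2) \<longlonglongrightarrow> 2 * 0 * (R\<^sup>2 * s * (2 * \<gamma>))\<^sup>2"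
    by (intro tendsto_intros vN Na)
  moreover have "\<forall>\<^sub>F n in sequentially. 2 * (real (v n) / N n) * (N n * a n)\<^sup>2 = 2 * v n * N n * (a n)\<^sup>2"
    using pos by eventually_elim (simp add: power2_eq_square)
  ultimately have "(\<lambda>n. 2 * v n * N n * (a n)\<^sup>2) \<longlonglongrightarrow> 0"
    by (simp add: Lim_transform_eventually)
  then have "(\<lambda>n. sqrt ((1 / real (m n) + 2 * v n * N n * (a n)\<^sup>2) * exp (N n * a n)))
      \<longlonglongrightarrow> sqrt ((0 + 0) * exp (R\<^sup>2 * s * (2 * \<gamma>)))"
    by (intro tendsto_intros minv Na)
  then show ?thesis by (simp add: power_divide)
qed

section \<open>Moments of the normalised weights\<close>

text \<open>The variable \<zeta> of the overview as a function of a single weight, so that its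
  moments are computed once under \<mu> and transferred to every edge.\<close>

definition rel_weight :: "ereal measure \<Rightarrow> real \<Rightarrow> ereal \<Rightarrow> real" where
  "rel_weight \<mu> \<beta> x = exp_weight \<beta> x / exp (psi \<mu> \<beta>) - 1"

lemma rel_weight_measurable [measurable]: "rel_weight \<mu> \<beta> \<in> borel_measurable borel"
  unfolding rel_weight_def[abs_def] by measurable

lemma rel_weight_ge: "rel_weight \<mu> \<beta> x \<ge> - 1"
  by (simp add: rel_weight_def exp_weight_nonneg)

lemma rel_weight_moments:
  assumes prob: "prob_space \<mu>" and sets: "sets \<mu> = sets borel"
    and not_inf: "\<not> (AE x in \<mu>. x = \<infinity>)"
    and int: "\<And>b. b \<ge> 0 \<Longrightarrow> integrable \<mu> (exp_weight b)" and \<beta>: "\<beta> \<ge> 0"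
  shows "integrable \<mu> (rel_weight \<mu> \<beta>)" "integrable \<mu> (\<lambda>x. (rel_weight \<mu> \<beta> x)\<^sup>2)"
    "integrable \<mu> (\<lambda>x. \<bar>rel_weight \<mu> \<beta> x\<bar> ^ 3)"
    "(\<integral>x. rel_weight \<mu> \<beta> x \<partial>\<mu>) = 0" "(\<integral>x. (rel_weight \<mu> \<beta> x)\<^sup>2 \<partial>\<mu>) = v_squared \<mu> \<beta>"
proof -
  interpret prob_space \<mu> by (rule prob)
  \<comment> \<open>A weight that is not almost surely infinite makes this expectation positive, so
    \<open>exp\<close> does undo the \<open>ln\<close> in \<open>psi\<close>.\<close>
  have exp_psi: "exp (psi \<mu> b) = (\<integral>x. exp_weight b x \<partial>\<mu>)" if "b \<ge> 0" for b
  proof -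
    have "(\<integral>x. exp_weight b x \<partial>\<mu>) \<noteq> 0"
    proof
      assume "(\<integral>x. exp_weight b x \<partial>\<mu>) = 0"
      then have "AE x in \<mu>. exp_weight b x = 0"
        using integral_nonneg_eq_0_iff_AE[OF int[OF that]] by (simp add: exp_weight_nonneg)
      then have "AE x in \<mu>. x = \<infinity>"
        by eventually_elim (auto simp: exp_weight_def split: if_splits)
      then show False using not_inf by contradiction
    qed
    moreover have "(\<integral>x. exp_weight b x \<partial>\<mu>) \<ge> 0"
      by (simp add: exp_weight_nonneg)
    ultimately show ?thesis by (simp add: psi_def)
  qed
  define K where "K = exp (psi \<mu> \<beta>)"
  have K: "K > 0" "K = (\<integral>x. exp_weight \<beta> x \<partial>\<mu>)" unfolding K_def by (simp_all add: exp_psi[OF \<beta>, symmetric])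
  \<comment> \<open>Powers of \<open>exp_weight \<beta>\<close> are again exponential weights, at
    the multiple \<open>k * \<beta>\<close>, hence integrable by hypothesis.\<close>
  have int_pow: "integrable \<mu> (\<lambda>x. exp_weight \<beta> x ^ k)" for k
    using int[of "k * \<beta>"] \<beta> by (cases "k = 0") (simp_all add: exp_weight_power)
  note int1 = int[OF \<beta>]
  have meas [measurable]: "rel_weight \<mu> \<beta> \<in> borel_measurable \<mu>"
    unfolding measurable_cong_sets[OF sets refl] by (rule rel_weight_measurable)
  have eq: "rel_weight \<mu> \<beta> = (\<lambda>x. exp_weight \<beta> x / K - 1)" by (simp add: rel_weight_def[abs_def] K_def)
  show 1: "integrable \<mu> (rel_weight \<mu> \<beta>)" unfolding eq using int1 by simp
  have sq: "(rel_weight \<mu> \<beta> x)\<^sup>2 = exp_weight \<beta> x ^ 2 / K\<^sup>2 - 2 / K * exp_weight \<beta> x + 1" for x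
    unfolding eq using K(1) by (simp add: power2_diff power_divide)
  show "integrable \<mu> (\<lambda>x. (rel_weight \<mu> \<beta> x)\<^sup>2)" unfolding sq using int1 int_pow[of 2] by simp
  show "(\<integral>x. rel_weight \<mu> \<beta> x \<partial>\<mu>) = 0" unfolding eq using int1 K by (simp add: prob_space)
  have "(\<integral>x. (rel_weight \<mu> \<beta> x)\<^sup>2 \<partial>\<mu>) = (\<integral>x. exp_weight \<beta> x ^ 2 \<partial>\<mu>) / K\<^sup>2 - 1"
    unfolding sq using int1 int_pow[of 2] K by (simp add: prob_space)
  also have "(\<integral>x. exp_weight \<beta> x ^ 2 \<partial>\<mu>) = exp (psi \<mu> (2 * \<beta>))"
    using exp_psi[of "2 * \<beta>"] \<beta> by (simp add: exp_weight_power)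
  also have "\<dots> / K\<^sup>2 - 1 = v_squared \<mu> \<beta>"
    by (simp add: v_squared_def K_def exp_diff exp_double)
  finally show "(\<integral>x. (rel_weight \<mu> \<beta> x)\<^sup>2 \<partial>\<mu>) = v_squared \<mu> \<beta>" .
  \<comment> \<open>A majorant for the third absolute moment, as
    \<open>\<bar>y - 1\<bar> \<le> y + 1\<close> for \<open>y \<ge> 0\<close>.\<close>
  have "integrable \<mu> (\<lambda>x. (exp_weight \<beta> x / K + 1) ^ 3)"
    using int_pow by (simp add: binomial_ring power_divide)
  then show "integrable \<mu> (\<lambda>x. \<bar>rel_weight \<mu> \<beta> x\<bar> ^ 3)"
  proof (rule Bochner_Integration.integrable_bound)
    have "\<bar>rel_weight \<mu> \<beta> x\<bar> ^ 3 \<le> (exp_weight \<beta> x / K + 1) ^ 3" for x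
      using K(1) exp_weight_nonneg[of \<beta> x] unfolding eq
      by (intro power_mono) (auto simp: abs_le_iff)
    then show "AE x in \<mu>. norm (\<bar>rel_weight \<mu> \<beta> x\<bar> ^ 3) \<le> norm ((exp_weight \<beta> x / K + 1) ^ 3)"
      using K(1) by (simp add: exp_weight_nonneg power_abs)
  qed simp
qed

lemma total_weight_measurable:
  assumes "\<And>e. e \<in> \<pi> \<Longrightarrow> w e \<in> borel_measurable M"
  shows "(\<lambda>x. total_weight (\<lambda>e. w e x) \<pi>) \<in> borel_measurable M"
  unfolding total_weight_def using assms by (intro borel_measurable_ereal_sum) auto

lemma partition_function_measurable:
  assumes "\<And>e. e \<in> E \<Longrightarrow> w e \<in> borel_measurable M" "S \<subseteq> Pow E"
  shows "(\<lambda>x. partition_function S (\<lambda>e. w e x) \<beta>) \<in> borel_measurable M"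
  unfolding partition_function_def using assms
  by (intro borel_measurable_divide borel_measurable_sum measurable_compose[OF total_weight_measurable exp_weight_measurable]) auto

section \<open>Convergence in law of the normalised free energy\<close>

theorem theorem2p2:
  fixes V :: "nat \<Rightarrow> 'a set" and E :: "nat \<Rightarrow> 'a set set"
    and S :: "nat \<Rightarrow> 'a set set set"
    and c :: nat and m :: "nat \<Rightarrow> nat" and \<gamma> \<beta> :: real
    and \<mu> :: "ereal measure"
    and M :: "nat \<Rightarrow> 'w measure" and \<omega> :: "nat \<Rightarrow> 'a set \<Rightarrow> 'w \<Rightarrow> ereal"
  assumes graph: "\<And>n. n \<ge> 1 \<Longrightarrow> simple_graph (V n) (E n)"
    and edge_trans: "\<And>n. n \<ge> 1 \<Longrightarrow> edge_transitive (V n) (E n)"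
    and card_V: "\<And>n. n \<ge> 1 \<Longrightarrow> card (V n) = c * n"
    and card_E: "(\<lambda>n. real (card (E n))) \<in> \<Theta>(\<lambda>n. real (card (V n)) ^ 2)"
    and law_prob: "prob_space \<mu>" and law_sets: "sets \<mu> = sets borel"
    and law_not_minf: "AE x in \<mu>. x \<noteq> -\<infinity>"
    and law_not_inf: "\<not> (AE x in \<mu>. x = \<infinity>)"
    and law_exp: "\<And>b. b \<ge> 0 \<Longrightarrow> integrable \<mu> (exp_weight b)"
    and space: "\<And>n. n \<ge> 1 \<Longrightarrow> prob_space (M n)"
    and weights_indep: "\<And>n. n \<ge> 1 \<Longrightarrow> prob_space.indep_vars (M n) (\<lambda>_. borel) (\<omega> n) (E n)"
    and weights_law: "\<And>n e. n \<ge> 1 \<Longrightarrow> e \<in> E n \<Longrightarrow> distr (M n) borel (\<omega> n e) = \<mu>"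
    and S_sub: "\<And>n. n \<ge> 1 \<Longrightarrow> S n \<subseteq> Pow (E n)"
    and S_nonempty: "\<And>n. n \<ge> 1 \<Longrightarrow> S n \<noteq> {}"
    and S_card: "\<And>n \<pi>. n \<ge> 1 \<Longrightarrow> \<pi> \<in> S n \<Longrightarrow> card \<pi> = m n"
    and gamma_pos: "\<gamma> > 0"
    and gamma_lim: "(\<lambda>n. real (m n) ^ 2 / (2 * real (card (E n)))) \<longlonglongrightarrow> \<gamma>"
    and matching_ext: "\<And>n \<Gamma>. n \<ge> 1 \<Longrightarrow> partial_matching (E n) \<Gamma> \<Longrightarrow> \<exists>\<pi>\<in>S n. \<Gamma> \<subseteq> \<pi>"
    and matching_prob: "\<exists>\<rho>>0. \<forall>n\<ge>1. \<forall>k. \<forall>\<Gamma>. partial_matching (E n) \<Gamma> \<and> card \<Gamma> = k \<longrightarrow>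
          \<bar>P0 (S n) (\<lambda>\<pi>. \<Gamma> \<subseteq> \<pi>) / (\<Prod>e\<in>\<Gamma>. P0 (S n) (\<lambda>\<pi>. e \<in> \<pi>)) - 1\<bar> \<le> \<rho> ^ k / sqrt (real (m n))"
    and nonmatching_prob: "\<exists>\<rho>>0. \<forall>n\<ge>1. \<forall>k. \<forall>\<Gamma>\<in>subset_closure (S n).
          \<not> partial_matching (E n) \<Gamma> \<and> card \<Gamma> = k \<longrightarrow>
          P0 (S n) (\<lambda>\<pi>. \<Gamma> \<subseteq> \<pi>) \<le> \<rho> ^ k * (\<Prod>e\<in>\<Gamma>. P0 (S n) (\<lambda>\<pi>. e \<in> \<pi>))"
    and edge_prob: "\<And>n e. n \<ge> 1 \<Longrightarrow> e \<in> E n \<Longrightarrow>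
          P0 (S n) (\<lambda>\<pi>. e \<in> \<pi>) = real (m n) / real (card (E n))"
    and beta: "\<beta> \<ge> 0"
  shows "weak_convergence
     (\<lambda>n. distr (M n) borel
        (\<lambda>x. log_ext (partition_function (S n) (\<lambda>e. \<omega> n e x) \<beta>) - ereal (real (m n) * psi \<mu> \<beta>)))
     (distr (normal_law (- \<gamma> * v_squared \<mu> \<beta>) (2 * \<gamma> * v_squared \<mu> \<beta>)) borel ereal)"
proof -
  define N where "N n = card (E n)" for n
  define v where "v n = card (V n)" for n
  define p where "p n = real (m n) / real (N n)" for n
  define s where "s = v_squared \<mu> \<beta>"
  define \<xi> where "\<xi> = rel_weight \<mu> \<beta>"
  \<comment> \<open>\<open>X\<close> is almost surely the partition function divided by
    \<open>exp (m * psi \<mu> \<beta>)\<close>, and \<open>Y\<close> is the product that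
    approximates it.\<close>
  define X where "X n x = (\<Sum>\<pi>\<in>S n. \<Prod>e\<in>\<pi>. 1 + \<xi> (\<omega> n e x)) / card (S n)" for n x
  define Y where "Y n x = (\<Prod>e\<in>E n. 1 + p n * \<xi> (\<omega> n e x))" for n x
  define G where "G = normal_law (- \<gamma> * s) (2 * \<gamma> * s)"
  note moments = rel_weight_moments[OF law_prob law_sets law_not_inf law_exp beta, folded \<xi>_def s_def]
  have \<xi> [measurable]: "\<xi> \<in> borel_measurable borel" by (simp add: \<xi>_def)
  have \<xi>_ge: "\<xi> x \<ge> - 1" for x by (simp add: \<xi>_def rel_weight_ge)
  have s: "s \<ge> 0" using Bochner_Integration.integral_nonneg[of \<mu> "\<lambda>x. (\<xi> x)\<^sup>2"] moments(5) by simp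
  have G: "real_distribution G" unfolding G_def using s gamma_pos by (intro real_distribution_normal_law) simp
  have fE: "finite (E n)" if "n \<ge> 1" for n
    using graph[OF that] by (auto simp: simple_graph_def intro: finite_subset[of "E n" "Pow (V n)"])
  have fS: "finite (S n)" if "n \<ge> 1" for n
    using S_sub[OF that] fE[OF that] finite_subset by auto
  have \<omega>: "\<omega> n e \<in> borel_measurable (M n)" if "n \<ge> 1" "e \<in> E n" for n e
    using weights_indep[OF that(1)] that(2) unfolding prob_space.indep_vars_def[OF space[OF that(1)]] by blast

  have asym: "(\<lambda>n. N n * (p n)\<^sup>2) \<longlonglongrightarrow> 2 * \<gamma>" "p \<longlonglongrightarrow> 0" "(\<lambda>n. 1 / real (m n)) \<longlonglongrightarrow> 0"
    "(\<lambda>n. real (v n) / N n) \<longlonglongrightarrow> 0" "\<forall>\<^sub>F n in sequentially. p n > 0"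
    unfolding p_def[abs_def]
    using density_asymptotics[of v c N \<gamma> m] card_V card_E gamma_pos gamma_lim by (auto simp: v_def N_def)
  have p_nonneg: "p n \<ge> 0" for n by (simp add: p_def)
  have ev_p: "\<forall>\<^sub>F n in sequentially. p n > 0 \<and> p n < 1 \<and> N n > 0 \<and> n \<ge> 1"
    using asym(5) order_tendstoD(2)[OF asym(2) zero_less_one] eventually_ge_at_top[of 1]
    by eventually_elim (auto simp: p_def zero_less_divide_iff)

  obtain \<rho>1 where \<rho>1: "\<rho>1 > 0" "\<And>n \<Gamma>. n \<ge> 1 \<Longrightarrow> partial_matching (E n) \<Gamma> \<Longrightarrow>
      \<bar>P0 (S n) (\<lambda>\<pi>. \<Gamma> \<subseteq> \<pi>) / (\<Prod>e\<in>\<Gamma>. P0 (S n) (\<lambda>\<pi>. e \<in> \<pi>)) - 1\<bar> \<le> \<rho>1 ^ card \<Gamma> * (1 / sqrt (m n))"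
    using matching_prob by auto
  obtain \<rho>2 where \<rho>2: "\<rho>2 > 0" "\<And>n \<Gamma>. n \<ge> 1 \<Longrightarrow> \<Gamma> \<in> subset_closure (S n) \<Longrightarrow> \<not> partial_matching (E n) \<Gamma> \<Longrightarrow>
      P0 (S n) (\<lambda>\<pi>. \<Gamma> \<subseteq> \<pi>) \<le> \<rho>2 ^ card \<Gamma> * (\<Prod>e\<in>\<Gamma>. P0 (S n) (\<lambda>\<pi>. e \<in> \<pi>))"
    using nonmatching_prob by auto
  \<comment> \<open>One constant serves both probability bounds; the 1 makes
    \<open>p ^ k \<le> (R * p) ^ k\<close>.\<close>
  define R where "R = max 1 (max \<rho>1 \<rho>2)"
  define a where "a n = (R * p n)\<^sup>2 * s" for n
  \<comment> \<open>The bound on the squared L2 error for the relative accuracy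
    \<open>\<delta> = 1 / sqrt m\<close> of matchings.\<close>
  define b where "b n = ((1 / sqrt (real (m n)))\<^sup>2 + 2 * v n * N n * (a n)\<^sup>2) * exp (N n * a n)" for n

  have L1: "integrable (M n) (\<lambda>x. X n x - Y n x)"
      "(\<integral>x. \<bar>X n x - Y n x\<bar> \<partial>M n)
        \<le> sqrt (\<Sum>\<Gamma>\<in>Pow (E n). (P0 (S n) (\<lambda>\<pi>. \<Gamma> \<subseteq> \<pi>) - p n ^ card \<Gamma>)\<^sup>2 * s ^ card \<Gamma>)"
    if n: "n \<ge> 1" for n
  proof -
    interpret prob_space "M n" by (rule space[OF n])
    have ind: "indep_vars (\<lambda>_. borel) (\<lambda>e x. \<xi> (\<omega> n e x)) (E n)"
      by (rule indep_vars_compose2[OF weights_indep[OF n]]) measurable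
    have mom: "integrable (M n) (\<lambda>x. \<xi> (\<omega> n e x))" "integrable (M n) (\<lambda>x. (\<xi> (\<omega> n e x))\<^sup>2)"
      "expectation (\<lambda>x. \<xi> (\<omega> n e x)) = 0" "expectation (\<lambda>x. (\<xi> (\<omega> n e x))\<^sup>2) = s" if e: "e \<in> E n" for e
    proof -
      note [measurable] = \<omega>[OF n e]
      note law = weights_law[OF n e]
      show "integrable (M n) (\<lambda>x. \<xi> (\<omega> n e x))" "integrable (M n) (\<lambda>x. (\<xi> (\<omega> n e x))\<^sup>2)"
        "expectation (\<lambda>x. \<xi> (\<omega> n e x)) = 0" "expectation (\<lambda>x. (\<xi> (\<omega> n e x))\<^sup>2) = s"
        using moments(1,2,4,5) unfolding law[symmetric] by (simp_all add: integrable_distr_eq integral_distr)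
    qed
    note L1 = L1_distance_le[OF fE[OF n] S_sub[OF n] S_nonempty[OF n] ind mom, of "p n"]
    show "integrable (M n) (\<lambda>x. X n x - Y n x)" using L1(1) unfolding X_def Y_def .
    show "(\<integral>x. \<bar>X n x - Y n x\<bar> \<partial>M n)
        \<le> sqrt (\<Sum>\<Gamma>\<in>Pow (E n). (P0 (S n) (\<lambda>\<pi>. \<Gamma> \<subseteq> \<pi>) - p n ^ card \<Gamma>)\<^sup>2 * s ^ card \<Gamma>)"
      using L1(2) unfolding X_def Y_def .
  qed
  have "\<forall>\<^sub>F n in sequentially. norm (\<integral>x. \<bar>X n x - Y n x\<bar> \<partial>M n) \<le> sqrt (b n)"
    using ev_p
  proof eventually_elim
    case (elim n)
    then have n: "n \<ge> 1" by simp
    have edge: "P0 (S n) (\<lambda>\<pi>. e \<in> \<pi>) = p n" if "e \<in> E n" for e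
      using edge_prob[OF n that] by (simp add: p_def N_def)
    have R: "R \<ge> 1" "R \<ge> \<rho>1" "R \<ge> \<rho>2" by (auto simp: R_def)
    note err = coefficient_error[OF fS[OF n] S_nonempty[OF n] _ R \<rho>1(1) \<rho>2(1) edge _ \<rho>1(2)[OF n] \<rho>2(2)[OF n]]
    have "(\<Sum>\<Gamma>\<in>Pow (E n). (P0 (S n) (\<lambda>\<pi>. \<Gamma> \<subseteq> \<pi>) - p n ^ card \<Gamma>)\<^sup>2 * s ^ card \<Gamma>) \<le> b n"
      unfolding b_def N_def v_def
      by (rule sum_coefficient_error_le[OF graph[OF n] s _ _ a_def]; intro err) (use elim in auto)
    with L1(2)[OF n] have "(\<integral>x. \<bar>X n x - Y n x\<bar> \<partial>M n) \<le> sqrt (b n)"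
      by (meson order_trans real_sqrt_le_mono)
    then show ?case by simp
  qed
  moreover have "(\<lambda>n. sqrt (b n)) \<longlonglongrightarrow> 0"
    unfolding b_def a_def
    by (rule L1_bound_tendsto_0[OF asym(1,3,4)]) (use ev_p in \<open>auto elim: eventually_mono\<close>)
  ultimately have L1_lim: "(\<lambda>n. \<integral>x. \<bar>X n x - Y n x\<bar> \<partial>M n) \<longlonglongrightarrow> 0"
    by (rule Lim_null_comparison)

  have char_lim: "(\<lambda>n. char (distr (M n) borel (\<lambda>x. ln (Y n x))) t) \<longlonglongrightarrow> char G t" for t
  proof (rule Lim_transform_eventually)
    show "(\<lambda>n. (CLINT x|\<mu>. iexp (t * ln (1 + p n * \<xi> x))) ^ N n) \<longlonglongrightarrow> char G t"
      unfolding G_def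
      using \<xi>_ge moments p_nonneg asym(1,2) gamma_pos \<xi>
      by (intro char_power_tendsto_normal law_prob) (auto simp: measurable_cong_sets[OF law_sets refl])
    show "\<forall>\<^sub>F n in sequentially. (CLINT x|\<mu>. iexp (t * ln (1 + p n * \<xi> x))) ^ N n
        = char (distr (M n) borel (\<lambda>x. ln (Y n x))) t"
      using ev_p
    proof eventually_elim
      case (elim n)
      then have n: "n \<ge> 1" by simp
      show ?case unfolding Y_def N_def
        using elim by (intro prob_space.char_ln_prod[symmetric] space fE weights_indep weights_law n \<xi> \<xi>_ge) auto
    qed
  qed
  have pos: "\<forall>\<^sub>F n in sequentially. \<forall>x. Y n x > 0"
    using ev_p
  proof eventually_elim
    case (elim n)
    have "1 + p n * \<xi> y > 0" for y
    proof -
      have "p n * \<xi> y \<ge> - p n" using mult_left_mono[OF \<xi>_ge[of y], of "p n"] elim by simp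
      then show ?thesis using elim by linarith
    qed
    then show ?case by (simp add: Y_def prod_pos)
  qed
  have X_meas: "X n \<in> borel_measurable (M n)" and Y_meas: "Y n \<in> borel_measurable (M n)" if "n \<ge> 1" for n
  proof -
    have "(\<lambda>x. \<xi> (\<omega> n e x)) \<in> borel_measurable (M n)" if "e \<in> E n" for e
      using measurable_compose[OF \<omega>[OF \<open>n \<ge> 1\<close> that] \<xi>] .
    then show "X n \<in> borel_measurable (M n)" "Y n \<in> borel_measurable (M n)"
      unfolding X_def[abs_def] Y_def[abs_def] using S_sub[OF that]
      by (auto intro!: borel_measurable_divide borel_measurable_sum borel_measurable_prod
            borel_measurable_add borel_measurable_times)
  qed

  show ?thesis
    unfolding weak_convergence_def
  proof (intro allI impI, elim conjE)
    fix f :: "ereal \<Rightarrow> real"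
    assume f: "continuous_on UNIV f" "bounded (range f)"
    have [measurable]: "f \<in> borel_measurable borel" using f(1) by (rule borel_measurable_continuous_onI)
    \<comment> \<open>Weak convergence is thus reduced to real variables: \<open>g\<close> tests
      \<open>X\<close> as \<open>f\<close> tests its extended logarithm.\<close>
    define g where "g z = f (log_ext (max z 0))" for z :: real
    have g: "continuous_on UNIV g" "bounded (range g)"
      unfolding g_def using f(2)
      by (auto intro!: continuous_on_compose2[OF f(1) log_ext_max_continuous] intro: bounded_subset)
    text \<open>The hypotheses say nothing about \<open>n = 0\<close>, hence the shift.\<close>
    have "(\<lambda>n. \<integral>x. g (X (Suc n) x) \<partial>M (Suc n)) \<longlonglongrightarrow> (\<integral>x. g (exp x) \<partial>G)"
      using eventually_sequentially_Suc[THEN iffD2, OF pos] LIMSEQ_Suc[OF L1_lim] LIMSEQ_Suc[OF char_lim]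
      by (intro expectation_tendsto_of_char_ln[where Y = "\<lambda>n. Y (Suc n)"] space G X_meas Y_meas L1 g) auto
    then have lim: "(\<lambda>n. \<integral>x. g (X n x) \<partial>M n) \<longlonglongrightarrow> (\<integral>x. g (exp x) \<partial>G)"
      by (rule LIMSEQ_imp_Suc)
    interpret G: real_distribution G by (rule G)
    \<comment> \<open>As \<open>exp x\<close> is positive, the cut-off is inactive and the logarithm
      returns \<open>x\<close>.\<close>
    have "(\<integral>x. g (exp x) \<partial>G) = (\<integral>x. f (ereal x) \<partial>G)"
      by (simp add: g_def log_ext_def)
    also have "\<dots> = (\<integral>x. f x \<partial>distr G borel ereal)"
      by (simp add: integral_distr)
    finally have rhs: "(\<integral>x. g (exp x) \<partial>G) = (\<integral>x. f x \<partial>distr G borel ereal)" .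
    have lhs: "(\<integral>x. g (X n x) \<partial>M n) = (\<integral>x. f x \<partial>distr (M n) borel
        (\<lambda>x. log_ext (partition_function (S n) (\<lambda>e. \<omega> n e x) \<beta>) - ereal (real (m n) * psi \<mu> \<beta>)))"
      if n: "n \<ge> 1" for n
    proof -
      have [measurable]: "(\<lambda>x. partition_function (S n) (\<lambda>e. \<omega> n e x) \<beta>) \<in> borel_measurable (M n)"
        using \<omega>[OF n] S_sub[OF n] by (rule partition_function_measurable)
      note [measurable] = X_meas[OF n]
      have [measurable]: "g \<in> borel_measurable borel" using g(1) by (rule borel_measurable_continuous_onI)
      have "AE x in M n. \<omega> n e x \<noteq> -\<infinity>" if e: "e \<in> E n" for e
        using law_not_minf unfolding weights_law[OF n e, symmetric]
        by (subst (asm) AE_distr_iff) (auto simp: \<omega>[OF n e])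
      \<comment> \<open>Only finitely many edges occur, so the dummy value of
        \<open>exp_weight\<close> is avoided off a null set, which the integrals do not see.\<close>
      then have "AE x in M n. \<forall>e\<in>E n. \<omega> n e x \<noteq> -\<infinity>"
        using fE[OF n] by (intro AE_finite_allI)
      then have "AE x in M n. g (X n x) =
          f (log_ext (partition_function (S n) (\<lambda>e. \<omega> n e x) \<beta>) - ereal (real (m n) * psi \<mu> \<beta>))"
      proof eventually_elim
        case (elim x)
        have "X n x = (\<Sum>\<pi>\<in>S n. \<Prod>e\<in>\<pi>. exp_weight \<beta> (\<omega> n e x) / exp (psi \<mu> \<beta>)) / card (S n)"
          by (simp add: X_def \<xi>_def rel_weight_def)
        then have "log_ext (partition_function (S n) (\<lambda>e. \<omega> n e x) \<beta>) - ereal (real (m n) * psi \<mu> \<beta>)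
            = log_ext (X n x)"
          using log_ext_partition_function[OF fE[OF n] S_sub[OF n] S_card[OF n], of "\<lambda>e. \<omega> n e x" \<beta> "psi \<mu> \<beta>"] elim
          by simp
        moreover have "X n x \<ge> 0"
        proof -
          have "1 + \<xi> y \<ge> 0" for y using \<xi>_ge[of y] by linarith
          then show ?thesis unfolding X_def by (intro divide_nonneg_nonneg sum_nonneg prod_nonneg) auto
        qed
        ultimately show ?case by (simp add: g_def max_absorb1)
      qed
      then have "(\<integral>x. g (X n x) \<partial>M n) = (\<integral>x. f (log_ext (partition_function (S n) (\<lambda>e. \<omega> n e x) \<beta>)
          - ereal (real (m n) * psi \<mu> \<beta>)) \<partial>M n)"
        by (intro integral_cong_AE) measurable
      then show ?thesis by (simp add: integral_distr)
    qed
    show "(\<lambda>n. \<integral>x. f x \<partial>distr (M n) borel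
        (\<lambda>x. log_ext (partition_function (S n) (\<lambda>e. \<omega> n e x) \<beta>) - ereal (real (m n) * psi \<mu> \<beta>)))
      \<longlonglongrightarrow> (\<integral>x. f x \<partial>distr (normal_law (- \<gamma> * v_squared \<mu> \<beta>) (2 * \<gamma> * v_squared \<mu> \<beta>)) borel ereal)"
      using lim[unfolded rhs] unfolding G_def s_def
      by (rule Lim_transform_eventually) (auto simp: lhs intro: eventually_mono[OF eventually_ge_at_top[of 1]])
  qed
qed

end
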